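(* Let $(M,g)$ be a Riemannian manifold, possibly non-compact, with induced volume form $\mathrm{d}\mu$. If $\mathrm{Dens}(M)$ is equipped with the spherical differentiable structure, then the square root map $$\Phi:\big(\mathrm{Dens}(M),\mathcal{G}^{FR}\big)\longrightarrow\big(\mathbb{U}^\infty_{L^2},\mathcal{G}^{L^2}\big),\qquad\rho\longmapsto\sqrt{\rho},$$ is an isometry; that is, $\Phi$ is a diffeomorphism and $\mathcal{G}^{L^2}_{\Phi(\rho)}(d\Phi_\rho\theta,d\Phi_\rho\bar\theta)=\mathcal{G}^{FR}_\rho(\theta,\bar\theta)$ for all $\rho\in\mathrm{Dens}(M)$ and $\theta,\bar\theta\in T_\rho\mathrm{Dens}(M)$.
   Context: The space of smooth probability densities is $\mathrm{Dens}(M):=\{\rho\in C^\infty(M):\int_M\rho\,\mathrm{d}\mu=1,\ \rho>0\}$. The unit sphere of smooth functions is $\mathbb{S}^\infty_{L^2}(M):=\{f\in C^\infty(M,\mathbb{R}):\|f\|_{L^2}=1\}$, where $\|\cdot\|_{L^2}$ and $\langle\cdot,\cdot\rangle_{L^2}$ are the norm and inner product of $L^2(M,\mu)$. It carries the differentiable structure of a hypersurface of $C^\infty(M)$, with tangent spaces $T_f\mathbb{S}^\infty_{L^2}(M)=\{h\in C^\infty(M,\mathbb{R})\cap L^2(M,\mu):\langle f,h\rangle_{L^2}=0\}$, and the metric $\mathcal{G}^{L^2}$ is the restriction of $\langle\cdot,\cdot\rangle_{L^2}$ to these tangent spaces. $\mathbb{U}^\infty_{L^2}:=\{f\in\mathbb{S}^\infty_{L^2}(M):f>0\}$,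 with the structure, tangent spaces and metric inherited from $\mathbb{S}^\infty_{L^2}(M)$. The spherical differentiable structure on $\mathrm{Dens}(M)$ is the one for which the bijection $\Phi:\mathrm{Dens}(M)\to\mathbb{U}^\infty_{L^2}$, $\rho\mapsto\sqrt\rho$, is a diffeomorphism. With respect to it, $$T_\rho\mathrm{Dens}(M)=\Big\{\theta\in C^\infty(M,\mathbb{R}):\int_M\theta\,\mathrm{d}\mu=0,\ \frac{\theta}{\sqrt\rho}\in L^2(M,\mu)\Big\}.$$ The Fisher--Rao metric, normalized with the factor $1/4$, is $\mathcal{G}^{FR}_\rho(\theta,\bar\theta):=\frac14\int_M\frac{\theta\bar\theta}{\rho}\,\mathrm{d}\mu$. *)

theory Defs
  imports "HOL-Analysis.Analysis"
begin

section \<open>Riemannian manifolds\<close>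

text \<open>
  Iterated partial derivatives in coordinates of \<open>\<real>\<^sup>n\<close>. On an open set, a function is
  \<open>C\<^sup>\<infinity>\<close> iff all its iterated partial derivatives are differentiable.
\<close>

fun partials :: "'n::finite list \<Rightarrow> (real^'n \<Rightarrow> 'b::real_normed_vector) \<Rightarrow> real^'n \<Rightarrow> 'b" where
  "partials [] f = f"
| "partials (i # is) f = (\<lambda>y. frechet_derivative (partials is f) (at y) (axis i 1))"

definition smooth_on :: "(real^'n::finite) set \<Rightarrow> (real^'n \<Rightarrow> 'b::real_normed_vector) \<Rightarrow> bool" where
  "smooth_on W f \<longleftrightarrow> (\<forall>is. partials is f differentiable_on W)"

text \<open>
  The manifold is the whole type \<open>'m\<close>, whose topology is Hausdorff and second countable; its
  dimension is \<open>CARD('n)\<close>. A chart is an open domain together with a coordinate map, whose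
  values outside the domain are irrelevant.
\<close>

type_synonym ('m, 'n) chart = "'m set \<times> ('m \<Rightarrow> real^'n)"

definition param :: "('m, 'n) chart \<Rightarrow> real^'n \<Rightarrow> 'm" where
  "param c = inv_into (fst c) (snd c)"

definition is_chart :: "('m::topological_space, 'n::finite) chart \<Rightarrow> bool" where
  "is_chart c \<longleftrightarrow> open (fst c) \<and> open (snd c ` fst c) \<and>
     homeomorphism (fst c) (snd c ` fst c) (snd c) (param c)"

definition transition :: "('m, 'n) chart \<Rightarrow> ('m, 'n) chart \<Rightarrow> real^'n \<Rightarrow> real^'n" where
  "transition c d = snd d \<circ> param c"

definition smooth_atlas :: "('m::topological_space, 'n::finite) chart set \<Rightarrow> bool" where
  "smooth_atlas A \<longleftrightarrow> (\<forall>c\<in>A. is_chart c) \<and> (\<Union>c\<in>A. fst c) = UNIV \<and>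
     (\<forall>c\<in>A. \<forall>d\<in>A. smooth_on (snd c ` (fst c \<inter> fst d)) (transition c d))"

text \<open>
  The metric is given by its Gram matrix \<open>(g\<^sub>i\<^sub>j)\<close> in each chart of the atlas; the last
  condition is the transformation law of a covariant 2-tensor under change of coordinates.
\<close>

type_synonym ('m, 'n) metric_tensor = "('m, 'n) chart \<Rightarrow> 'm \<Rightarrow> real^'n^'n"

definition riemannian_metric ::
    "('m::topological_space, 'n::finite) chart set \<Rightarrow> ('m, 'n) metric_tensor \<Rightarrow> bool" where
  "riemannian_metric A g \<longleftrightarrow>
     (\<forall>c\<in>A. smooth_on (snd c ` fst c) (g c \<circ> param c)) \<and>
     (\<forall>c\<in>A. \<forall>p\<in>fst c. transpose (g c p) = g c p \<and> (\<forall>v. v \<noteq> 0 \<longrightarrow> v \<bullet> (g c p *v v) > 0)) \<and>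
     (\<forall>c\<in>A. \<forall>d\<in>A. \<forall>p\<in>fst c \<inter> fst d.
        (let J = matrix (frechet_derivative (transition c d) (at (snd c p)))
         in g c p = transpose J ** g d p ** J))"

definition riemannian_manifold ::
    "('m::{t2_space,second_countable_topology}, 'n::finite) chart set \<Rightarrow>
     ('m, 'n) metric_tensor \<Rightarrow> bool" where
  "riemannian_manifold A g \<longleftrightarrow> smooth_atlas A \<and> riemannian_metric A g"

text \<open>
  The Riemannian volume is the Borel measure which in every chart is
  \<open>\<surd>(det (g\<^sub>i\<^sub>j)) dx\<^sub>1\<dots>dx\<^sub>n\<close>. Orientability is not needed.
\<close>

definition riemannian_volume ::
    "('m::topological_space, 'n::finite) chart set \<Rightarrow> ('m, 'n) metric_tensor \<Rightarrow>
     'm measure \<Rightarrow> bool" where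
  "riemannian_volume A g \<mu> \<longleftrightarrow> sets \<mu> = sets borel \<and>
     (\<forall>c\<in>A. \<forall>B\<in>sets borel. B \<subseteq> fst c \<longrightarrow>
        emeasure \<mu> B = (\<integral>\<^sup>+y\<in>snd c ` B. ennreal (sqrt (det (g c (param c y)))) \<partial>lborel))"

section \<open>Smooth functions, densities, and the unit sphere\<close>

definition smooth_functions ::
    "('m::topological_space, 'n::finite) chart set \<Rightarrow> ('m \<Rightarrow> real) set" where
  "smooth_functions A = {f. \<forall>c\<in>A. smooth_on (snd c ` fst c) (f \<circ> param c)}"

definition square_integrable :: "'m measure \<Rightarrow> ('m \<Rightarrow> real) \<Rightarrow> bool" where
  "square_integrable \<mu> f \<longleftrightarrow> f \<in> borel_measurable \<mu> \<and> integrable \<mu> (\<lambda>x. (f x)\<^sup>2)"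

definition L2_inner :: "'m measure \<Rightarrow> ('m \<Rightarrow> real) \<Rightarrow> ('m \<Rightarrow> real) \<Rightarrow> real" where
  "L2_inner \<mu> f h = (\<integral>x. f x * h x \<partial>\<mu>)"

definition L2_norm :: "'m measure \<Rightarrow> ('m \<Rightarrow> real) \<Rightarrow> real" where
  "L2_norm \<mu> f = sqrt (L2_inner \<mu> f f)"

text \<open>
  The Bochner integral of a non-integrable function is 0. Integrability is therefore forced by
  the normalizations below (integral 1, norm 1), and in the tangent spaces it follows from the
  \<open>L\<^sup>2\<close> conditions, since \<open>\<theta> = \<surd>\<rho> * (\<theta> / \<surd>\<rho>)\<close> is a product of two \<open>L\<^sup>2\<close> functions.
\<close>

definition Dens ::
    "('m::topological_space, 'n::finite) chart set \<Rightarrow> 'm measure \<Rightarrow> ('m \<Rightarrow> real) set" where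
  "Dens A \<mu> = {\<rho> \<in> smooth_functions A. (\<integral>x. \<rho> x \<partial>\<mu>) = 1 \<and> (\<forall>x. \<rho> x > 0)}"

definition Dens_tangent ::
    "('m::topological_space, 'n::finite) chart set \<Rightarrow> 'm measure \<Rightarrow> ('m \<Rightarrow> real) \<Rightarrow>
     ('m \<Rightarrow> real) set" where
  "Dens_tangent A \<mu> \<rho> = {\<theta> \<in> smooth_functions A.
     (\<integral>x. \<theta> x \<partial>\<mu>) = 0 \<and> square_integrable \<mu> (\<lambda>x. \<theta> x / sqrt (\<rho> x))}"

definition FR_metric ::
    "'m measure \<Rightarrow> ('m \<Rightarrow> real) \<Rightarrow> ('m \<Rightarrow> real) \<Rightarrow> ('m \<Rightarrow> real) \<Rightarrow> real" where
  "FR_metric \<mu> \<rho> \<theta> \<theta>' = 1/4 * (\<integral>x. \<theta> x * \<theta>' x / \<rho> x \<partial>\<mu>)"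

definition Sphere ::
    "('m::topological_space, 'n::finite) chart set \<Rightarrow> 'm measure \<Rightarrow> ('m \<Rightarrow> real) set" where
  "Sphere A \<mu> = {f \<in> smooth_functions A. L2_norm \<mu> f = 1}"

definition Sphere_tangent ::
    "('m::topological_space, 'n::finite) chart set \<Rightarrow> 'm measure \<Rightarrow> ('m \<Rightarrow> real) \<Rightarrow>
     ('m \<Rightarrow> real) set" where
  "Sphere_tangent A \<mu> f =
     {h \<in> smooth_functions A. square_integrable \<mu> h \<and> L2_inner \<mu> f h = 0}"

definition Sphere_metric ::
    "'m measure \<Rightarrow> ('m \<Rightarrow> real) \<Rightarrow> ('m \<Rightarrow> real) \<Rightarrow> ('m \<Rightarrow> real) \<Rightarrow> real" where
  "Sphere_metric \<mu> f = L2_inner \<mu>"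

definition PosSphere ::
    "('m::topological_space, 'n::finite) chart set \<Rightarrow> 'm measure \<Rightarrow> ('m \<Rightarrow> real) set" where
  "PosSphere A \<mu> = {f \<in> Sphere A \<mu>. \<forall>x. f x > 0}"

abbreviation "PosSphere_tangent \<equiv> Sphere_tangent"
abbreviation "PosSphere_metric \<equiv> Sphere_metric"

section \<open>Differentiable structures given by curves\<close>

text \<open>
  Differentiable structures on sets of functions are described, as in convenient calculus
  (Kriegl and Michor), by their differentiable curves: a structure \<open>C\<close> assigns to each \<open>k\<close> the set
  \<open>C k\<close> of its \<open>C\<^sup>k\<close> curves \<open>\<real> \<rightarrow> X\<close>, and \<open>\<Inter>k. C k\<close> are the smooth curves.
\<close>

type_synonym 'a curve_structure = "nat \<Rightarrow> (real \<Rightarrow> 'a) set"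

definition substructure :: "'a set \<Rightarrow> 'a curve_structure \<Rightarrow> 'a curve_structure" where
  "substructure X C k = {c \<in> C k. range c \<subseteq> X}"

definition transported :: "('a \<Rightarrow> 'b) \<Rightarrow> 'a set \<Rightarrow> 'b curve_structure \<Rightarrow> 'a curve_structure" where
  "transported F X D k = {c. range c \<subseteq> X \<and> F \<circ> c \<in> D k}"

text \<open>
  Preserving \<open>C\<^sup>k\<close> curves for every \<open>k\<close> entails preserving smooth curves, which is smoothness in
  the sense of convenient calculus; conversely, smooth maps between open subsets of Fr\'echet
  spaces preserve \<open>C\<^sup>k\<close> curves for every \<open>k\<close>.
\<close>

definition smooth_map :: "'a curve_structure \<Rightarrow> 'b curve_structure \<Rightarrow> ('a \<Rightarrow> 'b) \<Rightarrow> bool" where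
  "smooth_map C D F \<longleftrightarrow> (\<forall>k. \<forall>c\<in>C k. F \<circ> c \<in> D k)"

definition diffeomorphism ::
    "'a set \<Rightarrow> 'a curve_structure \<Rightarrow> 'b set \<Rightarrow> 'b curve_structure \<Rightarrow> ('a \<Rightarrow> 'b) \<Rightarrow> bool" where
  "diffeomorphism X C Y D F \<longleftrightarrow>
     bij_betw F X Y \<and> smooth_map C D F \<and> smooth_map D C (inv_into X F)"

text \<open>
  The transported structure is the only one for which a given bijection is a diffeomorphism.
\<close>

lemma diffeomorphism_imp_transported:
  assumes "diffeomorphism X C Y D F" "\<And>k c. c \<in> C k \<Longrightarrow> range c \<subseteq> X"
  shows "C = transported F X D"
proof
  fix k
  have inj: "inj_on F X" using assms(1) by (auto simp: diffeomorphism_def bij_betw_def)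
  have "c \<in> C k" if "range c \<subseteq> X" "F \<circ> c \<in> D k" for c
  proof -
    have "inv_into X F \<circ> (F \<circ> c) \<in> C k"
      using assms(1) that(2) by (auto simp: diffeomorphism_def smooth_map_def)
    moreover have "inv_into X F \<circ> (F \<circ> c) = c"
      using that(1) inj by (auto simp: fun_eq_iff intro!: inv_into_f_f)
    ultimately show ?thesis by simp
  qed
  moreover have "range c \<subseteq> X" "F \<circ> c \<in> D k" if "c \<in> C k" for c
    using assms(1) assms(2)[OF that] that unfolding diffeomorphism_def smooth_map_def by auto
  ultimately show "C k = transported F X D k"
    unfolding transported_def by blast
qed

text \<open>
  Tangent vectors of spaces of functions are themselves functions: the pointwise velocities of
  \<open>C\<^sup>1\<close> curves. A map has differential \<open>w\<close> at \<open>p\<close> in direction \<open>v\<close> if it takes the curves through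
  \<open>p\<close> with velocity \<open>v\<close>, of which there must be one, to curves with velocity \<open>w\<close>. Here smooth
  curves would not suffice: if \<open>M\<close> is not compact, the positive functions are not open in the
  sphere, and a tangent vector need not be the velocity of a \<open>C\<^sup>2\<close> curve of positive functions.
\<close>

definition velocity :: "(real \<Rightarrow> 'm \<Rightarrow> real) \<Rightarrow> 'm \<Rightarrow> real" where
  "velocity c = (\<lambda>x. deriv (\<lambda>t. c t x) 0)"

definition has_differential ::
    "('m \<Rightarrow> real) curve_structure \<Rightarrow> ('l \<Rightarrow> real) curve_structure \<Rightarrow> (('m \<Rightarrow> real) \<Rightarrow> 'l \<Rightarrow> real) \<Rightarrow>
     ('m \<Rightarrow> real) \<Rightarrow> ('m \<Rightarrow> real) \<Rightarrow> ('l \<Rightarrow> real) \<Rightarrow> bool" where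
  "has_differential C D F p v w \<longleftrightarrow>
     (\<exists>c\<in>C 1. c 0 = p \<and> velocity c = v) \<and>
     (\<forall>c\<in>C 1. c 0 = p \<and> velocity c = v \<longrightarrow> F \<circ> c \<in> D 1 \<and> velocity (F \<circ> c) = w)"

definition differential ::
    "('m \<Rightarrow> real) curve_structure \<Rightarrow> ('l \<Rightarrow> real) curve_structure \<Rightarrow> (('m \<Rightarrow> real) \<Rightarrow> 'l \<Rightarrow> real) \<Rightarrow>
     ('m \<Rightarrow> real) \<Rightarrow> ('m \<Rightarrow> real) \<Rightarrow> 'l \<Rightarrow> real" where
  "differential C D F p v = (THE w. has_differential C D F p v w)"

section \<open>The structures on the sphere and on the densities\<close>

text \<open>
  The ambient Fr\'echet space of the sphere is \<open>E = C\<^sup>\<infinity>(M) \<inter> L\<^sup>2(M,\<mu>)\<close>; on a non-compact \<open>M\<close> the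
  \<open>L\<^sup>2\<close> norm, whose level set the sphere is, is not defined on all of \<open>C\<^sup>\<infinity>(M)\<close>. Convergence in
  \<open>E\<close> is locally uniform convergence of all derivatives together with \<open>L\<^sup>2\<close> convergence.
\<close>

definition L2_smooth_functions ::
    "('m::topological_space, 'n::finite) chart set \<Rightarrow> 'm measure \<Rightarrow> ('m \<Rightarrow> real) set" where
  "L2_smooth_functions A \<mu> = {f \<in> smooth_functions A. square_integrable \<mu> f}"

definition E_tendsto ::
    "('m::topological_space, 'n::finite) chart set \<Rightarrow> 'm measure \<Rightarrow>
     ('i \<Rightarrow> 'm \<Rightarrow> real) \<Rightarrow> ('m \<Rightarrow> real) \<Rightarrow> 'i filter \<Rightarrow> bool" where
  "E_tendsto A \<mu> u f \<F> \<longleftrightarrow>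
     (\<forall>c\<in>A. \<forall>K is. compact K \<and> K \<subseteq> snd c ` fst c \<longrightarrow>
        uniform_limit K (\<lambda>i. partials is (u i \<circ> param c)) (partials is (f \<circ> param c)) \<F>) \<and>
     ((\<lambda>i. L2_norm \<mu> (\<lambda>x. u i x - f x)) \<longlongrightarrow> 0) \<F>"

definition has_E_derivative ::
    "('m::topological_space, 'n::finite) chart set \<Rightarrow> 'm measure \<Rightarrow>
     (real \<Rightarrow> 'm \<Rightarrow> real) \<Rightarrow> ('m \<Rightarrow> real) \<Rightarrow> real \<Rightarrow> bool" where
  "has_E_derivative A \<mu> c d t \<longleftrightarrow> E_tendsto A \<mu> (\<lambda>s x. (c (t + s) x - c t x) / s) d (at 0)"

fun E_curves ::
    "('m::topological_space, 'n::finite) chart set \<Rightarrow> 'm measure \<Rightarrow> ('m \<Rightarrow> real) curve_structure" where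
  "E_curves A \<mu> 0 =
     {c. range c \<subseteq> L2_smooth_functions A \<mu> \<and> (\<forall>t. E_tendsto A \<mu> c (c t) (at t))}"
| "E_curves A \<mu> (Suc k) =
     {c. range c \<subseteq> L2_smooth_functions A \<mu> \<and>
         (\<exists>d\<in>E_curves A \<mu> k. \<forall>t. has_E_derivative A \<mu> c (d t) t)}"

text \<open>The derivative of a curve in \<open>E\<close> is in particular its pointwise derivative.\<close>

lemma has_E_derivative_pointwise:
  assumes "smooth_atlas A" "has_E_derivative A \<mu> c d t"
  shows "((\<lambda>t. c t x) has_real_derivative d x) (at t)"
proof -
  obtain ch where ch: "ch \<in> A" "x \<in> fst ch"
  proof -
    have "x \<in> (\<Union>c\<in>A. fst c)" using assms(1) by (simp add: smooth_atlas_def)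
    then show ?thesis using that by (rule UN_E)
  qed
  have "homeomorphism (fst ch) (snd ch ` fst ch) (snd ch) (param ch)"
    using assms(1) ch by (auto simp: smooth_atlas_def is_chart_def)
  then have px: "param ch (snd ch x) = x" using ch by (auto simp: homeomorphism_def)
  have lim: "\<forall>c'\<in>A. \<forall>K is. compact K \<and> K \<subseteq> snd c' ` fst c' \<longrightarrow>
      uniform_limit K (\<lambda>s. partials is ((\<lambda>x. (c (t + s) x - c t x) / s) \<circ> param c'))
        (partials is (d \<circ> param c')) (at 0)"
    using assms(2) by (simp add: has_E_derivative_def E_tendsto_def)
  have "compact {snd ch x} \<and> {snd ch x} \<subseteq> snd ch ` fst ch"
    using ch by simp
  note lim[rule_format, OF ch(1) this, of "[]"]
  then have "((\<lambda>s. ((\<lambda>x. (c (t + s) x - c t x) / s) \<circ> param ch) (snd ch x)) \<longlongrightarrow>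
      (d \<circ> param ch) (snd ch x)) (at 0)"
    unfolding partials.simps by (rule tendsto_uniform_limitI) simp
  then have "((\<lambda>s. (c (t + s) x - c t x) / s) \<longlongrightarrow> d x) (at 0)"
    by (simp add: px)
  then show ?thesis by (simp add: DERIV_def)
qed

definition Sphere_curves ::
    "('m::topological_space, 'n::finite) chart set \<Rightarrow> 'm measure \<Rightarrow> ('m \<Rightarrow> real) curve_structure" where
  "Sphere_curves A \<mu> = substructure (Sphere A \<mu>) (E_curves A \<mu>)"

definition PosSphere_curves ::
    "('m::topological_space, 'n::finite) chart set \<Rightarrow> 'm measure \<Rightarrow> ('m \<Rightarrow> real) curve_structure" where
  "PosSphere_curves A \<mu> = substructure (PosSphere A \<mu>) (Sphere_curves A \<mu>)"

definition sqrt_map :: "('m \<Rightarrow> real) \<Rightarrow> 'm \<Rightarrow> real" where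
  "sqrt_map \<rho> = (\<lambda>x. sqrt (\<rho> x))"

text \<open>The spherical differentiable structure.\<close>

definition Dens_curves ::
    "('m::topological_space, 'n::finite) chart set \<Rightarrow> 'm measure \<Rightarrow> ('m \<Rightarrow> real) curve_structure" where
  "Dens_curves A \<mu> = transported sqrt_map (Dens A \<mu>) (PosSphere_curves A \<mu>)"

abbreviation d_sqrt_map ::
    "('m::topological_space, 'n::finite) chart set \<Rightarrow> 'm measure \<Rightarrow> ('m \<Rightarrow> real) \<Rightarrow>
     ('m \<Rightarrow> real) \<Rightarrow> 'm \<Rightarrow> real" where
  "d_sqrt_map A \<mu> \<equiv> differential (Dens_curves A \<mu>) (PosSphere_curves A \<mu>) sqrt_map"

end

theory Submission
  imports Defs
begin

text \<open>
  The spherical structure on \<open>Dens(M)\<close> is transported along the square root, so the diffeomorphism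
  and the identity \<open>d\<Phi>\<^sub>\<rho> \<theta> = \<theta> / (2 \<surd>\<rho>)\<close> are formal, once it is known that every
  \<open>\<theta> \<in> T\<^sub>\<rho> Dens(M)\<close> is the velocity of some \<open>C\<^sup>1\<close> curve. With \<open>f = \<surd>\<rho>\<close> and
  \<open>h = \<theta> / (2 \<surd>\<rho>)\<close>, this curve is the square of the normalization of
  \<open>f + t h / (1 + (t h / f)\<^sup>2)\<close>: it is positive although \<open>h / f\<close> may be unbounded; its difference
  quotients are rational expressions in \<open>f\<close>, \<open>h\<close>, \<open>t\<close>, hence converge with all partial
  derivatives; and they are dominated by \<open>3 \<bar>h\<bar>\<close>, hence converge in \<open>L\<^sup>2\<close>. Normalizing does not
  change the velocity at \<open>0\<close> because \<open>h\<close> is orthogonal to \<open>f\<close>.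
\<close>

section \<open>Smooth functions on open subsets of Euclidean space\<close>

abbreviation partial :: "'n::finite \<Rightarrow> (real^'n \<Rightarrow> real) \<Rightarrow> real^'n \<Rightarrow> real" where
  "partial i f \<equiv> \<lambda>y. frechet_derivative f (at y) (axis i 1)"

text \<open>In \<open>partials\<close> the head of the list is the outermost derivative. Here the
  innermost one is split off instead, so that inductions on the order can pass from \<open>f\<close>
  to \<open>partial i f\<close>.\<close>

lemma partials_snoc: "partials (is @ [i]) f = partials is (partial i f)"
  by (induction "is") auto

lemma partial_eqI:
  assumes "(f has_derivative f') (at y)"
  shows "partial i f y = f' (axis i 1)"
  using frechet_derivative_at[OF assms] by simp

text \<open>\<open>frechet_derivative\<close> is chosen from the derivatives at the point, and on an
  open set \<open>f\<close> and \<open>g\<close> have the same ones. The equality thus holds even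
  where no derivative exists.\<close>

lemma partial_cong:
  assumes "open W" "\<And>x. x \<in> W \<Longrightarrow> f x = g x" "y \<in> W"
  shows "partial i f y = partial i g y"
proof -
  have "(f has_derivative D) (at y) \<longleftrightarrow> (g has_derivative D) (at y)" for D
    using assms has_derivative_transform_within_open[of f D y UNIV W g]
      has_derivative_transform_within_open[of g D y UNIV W f] by auto
  then show ?thesis by (simp add: frechet_derivative_def)
qed

lemma differentiable_on_open_has_derivative:
  assumes "f differentiable_on W" "open W" "y \<in> W"
  shows "(f has_derivative frechet_derivative f (at y)) (at y)"
  using assms by (metis at_within_open differentiable_on_def frechet_derivative_works)

lemma partial_add:
  assumes "open W" "f differentiable_on W" "g differentiable_on W" "y \<in> W"
  shows "partial i (\<lambda>x. f x + g x) y = partial i f y + partial i g y"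
  using assms by (intro partial_eqI derivative_intros differentiable_on_open_has_derivative)

lemma partial_mult:
  assumes "open W" "f differentiable_on W" "g differentiable_on W" "y \<in> W"
  shows "partial i (\<lambda>x. f x * g x) y = f y * partial i g y + partial i f y * g y"
proof -
  have "((\<lambda>x. f x * g x) has_derivative
      (\<lambda>v. f y * frechet_derivative g (at y) v + frechet_derivative f (at y) v * g y)) (at y)"
    using assms by (intro has_derivative_mult differentiable_on_open_has_derivative)
  from partial_eqI[OF this] show ?thesis .
qed

text \<open>The right-hand side consists of products of a constant, a partial derivative of
  \<open>f\<close> and \<open>inverse f\<close> itself, so an induction on the order can feed on its
  own conclusion.\<close>

lemma partial_inverse:
  assumes "open W" "f differentiable_on W" "\<And>x. x \<in> W \<Longrightarrow> f x \<noteq> 0" "y \<in> W"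
  shows "partial i (\<lambda>x. inverse (f x)) y = (-1) * (partial i f y * (inverse (f y) * inverse (f y)))"
proof -
  have "((\<lambda>x. inverse (f x)) has_derivative
      (\<lambda>v. - (inverse (f y) * frechet_derivative f (at y) v * inverse (f y)))) (at y)"
    using assms by (intro Deriv.has_derivative_inverse differentiable_on_open_has_derivative) auto
  from partial_eqI[OF this] show ?thesis by (simp add: mult_ac)
qed

text \<open>The factor 1 / sqrt f is written as sqrt f * inverse f, so that the square root recurs
  on the right and the remaining factors are covered by the rules for products and inverses.\<close>

lemma partial_sqrt:
  assumes "open W" "f differentiable_on W" "\<And>x. x \<in> W \<Longrightarrow> f x > 0" "y \<in> W"
  shows "partial i (\<lambda>x. sqrt (f x)) y = (1/2) * (partial i f y * (sqrt (f y) * inverse (f y)))"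
proof -
  have pos: "f y > 0" using assms by auto
  have "((\<lambda>x. sqrt (f x)) has_derivative
      (\<lambda>v. (frechet_derivative f (at y) v) * (inverse (sqrt (f y)) / 2))) (at y)"
    using assms by (intro has_derivative_real_sqrt differentiable_on_open_has_derivative) auto
  from partial_eqI[OF this] have "partial i (\<lambda>x. sqrt (f x)) y
      = partial i f y * (inverse (sqrt (f y)) / 2)" .
  moreover have "inverse (sqrt (f y)) = sqrt (f y) * inverse (f y)"
    using pos by (simp add: field_simps)
  ultimately show ?thesis by simp
qed

lemma partial_const: "partial i (\<lambda>x. c) = (\<lambda>y. 0)"
  by (simp add: frechet_derivative_const)

section \<open>Closure of smooth functions under sums, products, inverses and square roots\<close>

lemma differentiable_on_transform:
  assumes "\<And>x. x \<in> W \<Longrightarrow> f x = g x" "f differentiable_on W"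
  shows "g differentiable_on W"
  using assms has_derivative_transform[of _ W g f]
  unfolding differentiable_on_def differentiable_def by metis

lemma differentiable_on_inverse:
  assumes "f differentiable_on W" "\<And>x. x \<in> W \<Longrightarrow> f x \<noteq> (0::real)"
  shows "(\<lambda>x. inverse (f x)) differentiable_on W"
  using assms by (auto simp: differentiable_on_def intro!: differentiable_inverse)

lemma differentiable_on_sqrt:
  assumes "f differentiable_on W" "\<And>x. x \<in> W \<Longrightarrow> f x > (0::real)"
  shows "(\<lambda>x. sqrt (f x)) differentiable_on W"
  using assms has_derivative_real_sqrt unfolding differentiable_on_def differentiable_def by blast

text \<open>Smoothness cut off at order \<open>k\<close>, where \<open>k\<close> counts the partial
  derivatives taken before differentiability is asked for; order 0 already means differentiable. The
  recursion removes the innermost derivative, which is the form that the product and chain rules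
  deliver.\<close>

primrec differentiable_upto :: "nat \<Rightarrow> (real^'n::finite) set \<Rightarrow> (real^'n \<Rightarrow> real) \<Rightarrow> bool" where
  "differentiable_upto 0 W f \<longleftrightarrow> f differentiable_on W"
| "differentiable_upto (Suc k) W f \<longleftrightarrow>
     f differentiable_on W \<and> (\<forall>i. differentiable_upto k W (partial i f))"

text \<open>Lists are split at their last element, to match \<open>partials_snoc\<close>.\<close>

lemma all_lists_le_Suc:
  "(\<forall>is. length is \<le> Suc k \<longrightarrow> P is) \<longleftrightarrow> P [] \<and> (\<forall>i is. length is \<le> k \<longrightarrow> P (is @ [i]))"
  by (metis Suc_le_mono length_append_singleton list.size(3) rev_cases zero_le)

lemma differentiable_upto_iff:
  "differentiable_upto k W f \<longleftrightarrow> (\<forall>is. length is \<le> k \<longrightarrow> partials is f differentiable_on W)"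
proof (induction k arbitrary: f)
  case (Suc k)
  show ?case unfolding all_lists_le_Suc partials_snoc using Suc by auto
qed auto

lemma smooth_on_iff: "smooth_on W f \<longleftrightarrow> (\<forall>k. differentiable_upto k W f)"
  unfolding differentiable_upto_iff smooth_on_def by blast

lemma smooth_on_partial: "smooth_on W f \<Longrightarrow> smooth_on W (partial i f)"
  by (simp add: smooth_on_def flip: partials_snoc)

lemma smooth_on_differentiable: "smooth_on W f \<Longrightarrow> f differentiable_on W"
  unfolding smooth_on_def by (metis partials.simps(1))

lemma differentiable_upto_SucD: "differentiable_upto (Suc k) W f \<Longrightarrow> differentiable_upto k W f"
  unfolding differentiable_upto_iff by auto

lemma differentiable_upto_cong:
  assumes "open W" "\<And>x. x \<in> W \<Longrightarrow> f x = g x" "differentiable_upto k W f"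
  shows "differentiable_upto k W g"
  using assms(2,3)
proof (induction k arbitrary: f g)
  case 0
  then show ?case using differentiable_on_transform[of W f g] by simp
next
  case (Suc k)
  have "differentiable_upto k W (partial i g)" for i
    using Suc.IH[OF partial_cong[OF assms(1) Suc.prems(1)]] Suc.prems(2) by simp
  then show ?case using Suc.prems differentiable_on_transform[of W f g] by simp
qed

lemma differentiable_upto_const: "differentiable_upto k W (\<lambda>x. c)"
  by (induction k arbitrary: c) (auto simp: partial_const)

lemma differentiable_upto_add:
  assumes "open W" "differentiable_upto k W f" "differentiable_upto k W g"
  shows "differentiable_upto k W (\<lambda>x. f x + g x)"
  using assms(2,3)
proof (induction k arbitrary: f g)
  case (Suc k)
  have *: "differentiable_upto k W (\<lambda>y. partial i f y + partial i g y)" for i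
    using Suc by simp
  have "differentiable_upto k W (partial i (\<lambda>x. f x + g x))" for i
    by (rule differentiable_upto_cong[OF assms(1) _ *[of i]])
      (use Suc.prems in \<open>simp add: partial_add[OF assms(1)]\<close>)
  then show ?case using Suc.prems by auto
qed auto

text \<open>By the product rule the derivative is a sum of products of \<open>f\<close>,
  \<open>g\<close> and their partial derivatives, all of which are differentiable up to order
  \<open>k\<close>.\<close>

lemma differentiable_upto_mult:
  assumes "open W" "differentiable_upto k W f" "differentiable_upto k W g"
  shows "differentiable_upto k W (\<lambda>x. f x * g x)"
  using assms(2,3)
proof (induction k arbitrary: f g)
  case (Suc k)
  have *: "differentiable_upto k W (\<lambda>y. f y * partial i g y + partial i f y * g y)" for i
    using Suc.prems[THEN differentiable_upto_SucD] Suc.prems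
    by (intro differentiable_upto_add[OF assms(1)] Suc.IH) simp_all
  have "differentiable_upto k W (partial i (\<lambda>x. f x * g x))" for i
    by (rule differentiable_upto_cong[OF assms(1) _ *[of i]])
      (use Suc.prems in \<open>simp add: partial_mult[OF assms(1)]\<close>)
  then show ?case using Suc.prems by auto
qed auto

text \<open>Here \<open>f\<close> stays fixed in the induction: the derivative of 1 / f involves no
  other inverse than that of \<open>f\<close>, at one order less.\<close>

lemma differentiable_upto_inverse:
  assumes "open W" "differentiable_upto k W f" "\<And>x. x \<in> W \<Longrightarrow> f x \<noteq> 0"
  shows "differentiable_upto k W (\<lambda>x. inverse (f x))"
  using assms(2)
proof (induction k)
  case (Suc k)
  have *: "differentiable_upto k W (\<lambda>y. (-1) * (partial i f y * (inverse (f y) * inverse (f y))))" for i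
    using Suc.prems[THEN differentiable_upto_SucD] Suc.prems
    by (intro differentiable_upto_mult[OF assms(1)] differentiable_upto_const Suc.IH) auto
  have "differentiable_upto k W (partial i (\<lambda>x. inverse (f x)))" for i
    by (rule differentiable_upto_cong[OF assms(1) _ *[of i]])
      (use Suc.prems in \<open>simp add: partial_inverse[OF assms(1) _ assms(3)]\<close>)
  then show ?case using Suc.prems assms(3) by (auto intro!: differentiable_on_inverse)
qed (use assms(3) in \<open>auto intro!: differentiable_on_inverse\<close>)

lemma differentiable_upto_sqrt:
  assumes "open W" "differentiable_upto k W f" "\<And>x. x \<in> W \<Longrightarrow> f x > 0"
  shows "differentiable_upto k W (\<lambda>x. sqrt (f x))"
  using assms(2)
proof (induction k)
  case (Suc k)
  have nz: "f x \<noteq> 0" if "x \<in> W" for x using assms(3)[OF that] by simp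
  have *: "differentiable_upto k W (\<lambda>y. (1/2) * (partial i f y * (sqrt (f y) * inverse (f y))))" for i
    using Suc.prems[THEN differentiable_upto_SucD] Suc.prems nz
    by (intro differentiable_upto_mult[OF assms(1)] differentiable_upto_const Suc.IH
        differentiable_upto_inverse[OF assms(1)]) auto
  have "differentiable_upto k W (partial i (\<lambda>x. sqrt (f x)))" for i
    by (rule differentiable_upto_cong[OF assms(1) _ *[of i]])
      (use Suc.prems in \<open>simp add: partial_sqrt[OF assms(1) _ assms(3)]\<close>)
  then show ?case using Suc.prems assms(3) by (auto intro!: differentiable_on_sqrt)
qed (use assms(3) in \<open>auto intro!: differentiable_on_sqrt\<close>)

lemma smooth_on_closure:
  fixes f g :: "real^'n::finite \<Rightarrow> real"
  assumes "open W"
  shows smooth_on_const: "smooth_on W (\<lambda>x. c :: real)"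
    and smooth_on_add: "smooth_on W f \<Longrightarrow> smooth_on W g \<Longrightarrow> smooth_on W (\<lambda>x. f x + g x)"
    and smooth_on_mult: "smooth_on W f \<Longrightarrow> smooth_on W g \<Longrightarrow> smooth_on W (\<lambda>x. f x * g x)"
    and smooth_on_inverse: "smooth_on W f \<Longrightarrow> (\<And>x. x \<in> W \<Longrightarrow> f x \<noteq> 0) \<Longrightarrow>
      smooth_on W (\<lambda>x. inverse (f x))"
    and smooth_on_sqrt: "smooth_on W f \<Longrightarrow> (\<And>x. x \<in> W \<Longrightarrow> f x > 0) \<Longrightarrow>
      smooth_on W (\<lambda>x. sqrt (f x))"
  unfolding smooth_on_iff using assms
  by (simp_all add: differentiable_upto_const differentiable_upto_add differentiable_upto_mult
      differentiable_upto_inverse differentiable_upto_sqrt)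

section \<open>Uniform convergence on compact sets together with derivatives\<close>

primrec converges_upto :: "nat \<Rightarrow> (real^'n::finite) set \<Rightarrow> ('i \<Rightarrow> real^'n \<Rightarrow> real) \<Rightarrow>
    (real^'n \<Rightarrow> real) \<Rightarrow> 'i filter \<Rightarrow> bool" where
  "converges_upto 0 W u f F \<longleftrightarrow> (\<forall>K. compact K \<and> K \<subseteq> W \<longrightarrow> uniform_limit K u f F)"
| "converges_upto (Suc k) W u f F \<longleftrightarrow> (\<forall>K. compact K \<and> K \<subseteq> W \<longrightarrow> uniform_limit K u f F) \<and>
     (\<forall>i. converges_upto k W (\<lambda>j. partial i (u j)) (partial i f) F)"

lemma converges_upto_iff:
  "converges_upto k W u f F \<longleftrightarrow> (\<forall>is. length is \<le> k \<longrightarrow>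
     (\<forall>K. compact K \<and> K \<subseteq> W \<longrightarrow> uniform_limit K (\<lambda>j. partials is (u j)) (partials is f) F))"
proof (induction k arbitrary: u f)
  case (Suc k)
  show ?case unfolding all_lists_le_Suc partials_snoc using Suc by auto
qed auto

lemma converges_upto_SucD: "converges_upto (Suc k) W u f F \<Longrightarrow> converges_upto k W u f F"
  unfolding converges_upto_iff by auto

lemma converges_upto_cong:
  assumes "open W" "\<And>j x. x \<in> W \<Longrightarrow> u j x = v j x" "\<And>x. x \<in> W \<Longrightarrow> f x = g x"
    "converges_upto k W u f F"
  shows "converges_upto k W v g F"
  using assms(2-4)
proof (induction k arbitrary: u v f g)
  case 0
  have "uniform_limit K v g F" if "compact K" "K \<subseteq> W" for K
    using 0 that by (subst uniform_limit_cong'[of K v u g f]) auto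
  then show ?case by simp
next
  case (Suc k)
  have "uniform_limit K v g F" if "compact K" "K \<subseteq> W" for K
    using Suc.prems that by (subst uniform_limit_cong'[of K v u g f]) auto
  moreover have "converges_upto k W (\<lambda>j. partial i (v j)) (partial i g) F" for i
    using Suc.IH[OF partial_cong[OF assms(1) Suc.prems(1)] partial_cong[OF assms(1) Suc.prems(2)]]
      Suc.prems(3) by simp
  ultimately show ?case by simp
qed

lemma converges_upto_const:
  assumes "(a \<longlongrightarrow> b) F"
  shows "converges_upto k W (\<lambda>j x. a j) (\<lambda>x. b) F"
  using assms
proof (induction k arbitrary: a b)
  case 0
  then show ?case by (auto simp: uniform_limit_iff tendsto_iff elim!: eventually_mono)
next
  case (Suc k)
  then show ?case unfolding converges_upto.simps partial_const
    by (auto simp: uniform_limit_iff tendsto_iff elim!: eventually_mono)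
qed

text \<open>Smoothness of every member is assumed besides convergence, because the sum rule for the
  total function \<open>frechet_derivative\<close> applies only to differentiable functions.\<close>

lemma converges_upto_add:
  assumes "open W" "converges_upto k W u f F" "converges_upto k W v g F"
    "\<And>j. smooth_on W (u j)" "\<And>j. smooth_on W (v j)" "smooth_on W f" "smooth_on W g"
  shows "converges_upto k W (\<lambda>j x. u j x + v j x) (\<lambda>x. f x + g x) F"
  using assms(2-)
proof (induction k arbitrary: u v f g)
  case 0
  then show ?case by (simp add: uniform_limit_add)
next
  case (Suc k)
  have *: "converges_upto k W (\<lambda>j y. partial i (u j) y + partial i (v j) y)
      (\<lambda>y. partial i f y + partial i g y) F" for i
    using Suc.prems by (intro Suc.IH) (simp_all add: smooth_on_partial)
  have "converges_upto k W (\<lambda>j. partial i (\<lambda>x. u j x + v j x)) (partial i (\<lambda>x. f x + g x)) F" for i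
    by (rule converges_upto_cong[OF assms(1) _ _ *[of i]])
      (use Suc.prems in \<open>simp_all add: partial_add[OF assms(1)] smooth_on_differentiable\<close>)
  then show ?case using Suc.prems by (simp add: uniform_limit_add)
qed

text \<open>Products preserve uniform convergence when the limits are bounded; compactness of
  \<open>K\<close> and continuity of the limits provide the bounds.\<close>

lemma uniform_limit_mult_on_compact:
  fixes f g :: "'a::topological_space \<Rightarrow> real"
  assumes "compact K" "uniform_limit K u f F" "uniform_limit K v g F"
    "continuous_on K f" "continuous_on K g"
  shows "uniform_limit K (\<lambda>j x. u j x * v j x) (\<lambda>x. f x * g x) F"
  using assms
  by (intro uniform_lim_mult) (simp_all add: compact_imp_bounded compact_continuous_image)

lemma smooth_on_continuous: "smooth_on W f \<Longrightarrow> K \<subseteq> W \<Longrightarrow> continuous_on K f"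
  using smooth_on_differentiable differentiable_imp_continuous_on continuous_on_subset by blast

lemma converges_upto_mult:
  assumes "open W" "converges_upto k W u f F" "converges_upto k W v g F"
    "\<And>j. smooth_on W (u j)" "\<And>j. smooth_on W (v j)" "smooth_on W f" "smooth_on W g"
  shows "converges_upto k W (\<lambda>j x. u j x * v j x) (\<lambda>x. f x * g x) F"
  using assms(2-)
proof (induction k arbitrary: u v f g)
  case 0
  then show ?case by (simp add: uniform_limit_mult_on_compact smooth_on_continuous[where W = W])
next
  case (Suc k)
  have *: "converges_upto k W (\<lambda>j y. u j y * partial i (v j) y + partial i (u j) y * v j y)
      (\<lambda>y. f y * partial i g y + partial i f y * g y) F" for i
    using Suc.prems Suc.prems(1,2)[THEN converges_upto_SucD]
    by (intro converges_upto_add[OF assms(1)] Suc.IH)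
      (simp_all add: smooth_on_partial smooth_on_mult[OF assms(1)])
  have "converges_upto k W (\<lambda>j. partial i (\<lambda>x. u j x * v j x)) (partial i (\<lambda>x. f x * g x)) F" for i
    by (rule converges_upto_cong[OF assms(1) _ _ *[of i]])
      (use Suc.prems in \<open>simp_all add: partial_mult[OF assms(1)] smooth_on_differentiable\<close>)
  then show ?case using Suc.prems
    by (simp add: uniform_limit_mult_on_compact smooth_on_continuous[where W = W])
qed

text \<open>On a nonempty compact set the modulus of the limit attains a positive minimum, and away
  from zero inversion respects uniform convergence.\<close>

lemma uniform_limit_inverse_on_compact:
  fixes f :: "'a::topological_space \<Rightarrow> real"
  assumes "compact K" "uniform_limit K u f F" "continuous_on K f" "\<And>x. x \<in> K \<Longrightarrow> f x \<noteq> 0"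
  shows "uniform_limit K (\<lambda>j x. inverse (u j x)) (\<lambda>x. inverse (f x)) F"
proof (cases "K = {}")
  case False
  have "continuous_on K (\<lambda>x. norm (f x))" using assms by (intro continuous_intros)
  then obtain y where y: "y \<in> K" "\<And>x. x \<in> K \<Longrightarrow> norm (f y) \<le> norm (f x)"
    using continuous_attains_inf[OF assms(1) False] by blast
  show ?thesis
    using uniform_lim_inverse[OF assms(2) y(2)] y(1) assms(4) by (simp add: o_def)
qed simp

lemma converges_upto_inverse:
  assumes "open W" "converges_upto k W u f F"
    "\<And>j. smooth_on W (u j)" "smooth_on W f"
    and nz: "\<And>j x. x \<in> W \<Longrightarrow> u j x \<noteq> 0" "\<And>x. x \<in> W \<Longrightarrow> f x \<noteq> 0"
  shows "converges_upto k W (\<lambda>j x. inverse (u j x)) (\<lambda>x. inverse (f x)) F"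
  using assms(2)
proof (induction k)
  case 0
  then show ?case
    by (auto intro!: uniform_limit_inverse_on_compact smooth_on_continuous[OF assms(4)] nz)
next
  case (Suc k)
  have *: "converges_upto k W
      (\<lambda>j y. (-1) * (partial i (u j) y * (inverse (u j y) * inverse (u j y))))
      (\<lambda>y. (-1) * (partial i f y * (inverse (f y) * inverse (f y)))) F" for i
    using Suc.prems Suc.prems[THEN converges_upto_SucD] assms(3,4) nz
    by (intro converges_upto_mult[OF assms(1)] converges_upto_const Suc.IH tendsto_const
        smooth_on_closure[OF assms(1)] smooth_on_partial) auto
  have "converges_upto k W (\<lambda>j. partial i (\<lambda>x. inverse (u j x))) (partial i (\<lambda>x. inverse (f x))) F" for i
    by (rule converges_upto_cong[OF assms(1) _ _ *[of i]])
      (use assms(3,4) nz in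
        \<open>simp_all add: partial_inverse[OF assms(1)] smooth_on_differentiable\<close>)
  then show ?case using Suc.prems
    by (auto intro!: uniform_limit_inverse_on_compact smooth_on_continuous[OF assms(4)] nz)
qed

section \<open>Smooth functions and their convergence on the manifold\<close>

locale smooth_borel_manifold =
  fixes A :: "('m::{t2_space,second_countable_topology}, 'n::finite) chart set"
    and \<mu> :: "'m measure"
  assumes atlas: "smooth_atlas A" and sets_mu: "sets \<mu> = sets borel"
begin

lemma chart_props:
  assumes "c \<in> A"
  shows "open (fst c)" "open (snd c ` fst c)"
    "homeomorphism (fst c) (snd c ` fst c) (snd c) (param c)"
  using atlas assms by (auto simp: smooth_atlas_def is_chart_def)

lemma chart_cover: obtains c where "c \<in> A" "x \<in> fst c"
  using atlas unfolding smooth_atlas_def by blast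

lemma
  shows smooth_functions_const: "(\<lambda>x. a) \<in> smooth_functions A"
    and smooth_functions_add: "f \<in> smooth_functions A \<Longrightarrow> h \<in> smooth_functions A \<Longrightarrow>
      (\<lambda>x. f x + h x) \<in> smooth_functions A"
    and smooth_functions_mult: "f \<in> smooth_functions A \<Longrightarrow> h \<in> smooth_functions A \<Longrightarrow>
      (\<lambda>x. f x * h x) \<in> smooth_functions A"
    and smooth_functions_inverse: "f \<in> smooth_functions A \<Longrightarrow> (\<And>x. f x \<noteq> 0) \<Longrightarrow>
      (\<lambda>x. inverse (f x)) \<in> smooth_functions A"
    and smooth_functions_sqrt: "f \<in> smooth_functions A \<Longrightarrow> (\<And>x. f x > 0) \<Longrightarrow>
      (\<lambda>x. sqrt (f x)) \<in> smooth_functions A"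
  unfolding smooth_functions_def o_def
  by (auto intro!: smooth_on_const smooth_on_add smooth_on_mult smooth_on_inverse smooth_on_sqrt
      chart_props(2))

text \<open>Continuity in coordinates is pulled back along each chart and glued over the open chart
  domains. It is what makes smooth functions Borel measurable.\<close>

lemma smooth_functions_continuous:
  assumes "f \<in> smooth_functions A"
  shows "continuous_on UNIV f"
proof -
  have "continuous_on (fst c) f" if c: "c \<in> A" for c
  proof -
    have "continuous_on (snd c ` fst c) (f \<circ> param c)"
      using assms c smooth_on_continuous[OF _ subset_refl] unfolding smooth_functions_def by blast
    then have "continuous_on (fst c) ((f \<circ> param c) \<circ> snd c)"
      by (rule continuous_on_compose[rotated])
        (use chart_props(3)[OF c] in \<open>simp add: homeomorphism_def\<close>)
    then show ?thesis
      by (rule continuous_on_eq) (use chart_props(3)[OF c] in \<open>simp add: homeomorphism_def\<close>)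
  qed
  then have "continuous_on (\<Union>c\<in>A. fst c) f"
    using chart_props(1) by (intro continuous_on_open_UN) auto
  moreover have "(\<Union>c\<in>A. fst c) = UNIV" using atlas by (simp add: smooth_atlas_def)
  ultimately show ?thesis by simp
qed

lemma smooth_functions_measurable:
  "f \<in> smooth_functions A \<Longrightarrow> f \<in> borel_measurable \<mu>"
  using borel_measurable_continuous_onI[OF smooth_functions_continuous]
    measurable_cong_sets[OF sets_mu refl] by blast

section \<open>Convergence of all derivatives in every chart\<close>

definition Cinf_tendsto :: "('i \<Rightarrow> 'm \<Rightarrow> real) \<Rightarrow> ('m \<Rightarrow> real) \<Rightarrow> 'i filter \<Rightarrow> bool" where
  "Cinf_tendsto u f F \<longleftrightarrow>
     (\<forall>c\<in>A. \<forall>k. converges_upto k (snd c ` fst c) (\<lambda>i. u i \<circ> param c) (f \<circ> param c) F)"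

text \<open>Replacing the L2 norm by its square removes the square root, so that the L2 part can be
  estimated by integrals of squares.\<close>

lemma E_tendsto_iff:
  "E_tendsto A \<mu> u f F \<longleftrightarrow>
     Cinf_tendsto u f F \<and> ((\<lambda>i. \<integral>x. (u i x - f x)\<^sup>2 \<partial>\<mu>) \<longlongrightarrow> 0) F"
proof -
  let ?I = "\<lambda>i. \<integral>x. (u i x - f x)\<^sup>2 \<partial>\<mu>"
  have "((\<lambda>i. sqrt (?I i)) \<longlongrightarrow> 0) F \<longleftrightarrow> (?I \<longlongrightarrow> 0) F"
  proof
    assume "((\<lambda>i. sqrt (?I i)) \<longlongrightarrow> 0) F"
    from tendsto_power[OF this, of 2] show "(?I \<longlongrightarrow> 0) F" by simp
  next
    assume "(?I \<longlongrightarrow> 0) F"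
    from tendsto_real_sqrt[OF this] show "((\<lambda>i. sqrt (?I i)) \<longlongrightarrow> 0) F" by simp
  qed
  then show ?thesis
    unfolding E_tendsto_def Cinf_tendsto_def converges_upto_iff L2_norm_def L2_inner_def
      power2_eq_square by blast
qed

lemma Cinf_tendsto_const: "(a \<longlongrightarrow> b) F \<Longrightarrow> Cinf_tendsto (\<lambda>i x. a i) (\<lambda>x. b) F"
  unfolding Cinf_tendsto_def o_def by (simp add: converges_upto_const)

lemma Cinf_tendsto_refl: "Cinf_tendsto (\<lambda>i. f) f F"
  unfolding Cinf_tendsto_def converges_upto_iff by (simp add: uniform_limit_const)

lemma Cinf_tendstoI:
  "(\<And>c k. c \<in> A \<Longrightarrow>
      converges_upto k (snd c ` fst c) (\<lambda>i x. u i (param c x)) (\<lambda>x. f (param c x)) F) \<Longrightarrow>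
    Cinf_tendsto u f F"
  by (simp add: Cinf_tendsto_def o_def)

lemma Cinf_tendstoD:
  "Cinf_tendsto u f F \<Longrightarrow> c \<in> A \<Longrightarrow>
    converges_upto k (snd c ` fst c) (\<lambda>i x. u i (param c x)) (\<lambda>x. f (param c x)) F"
  by (simp add: Cinf_tendsto_def o_def)

lemma smooth_functionsD:
  "f \<in> smooth_functions A \<Longrightarrow> c \<in> A \<Longrightarrow> smooth_on (snd c ` fst c) (\<lambda>x. f (param c x))"
  by (simp add: smooth_functions_def o_def)

lemma
  assumes u: "\<And>i. u i \<in> smooth_functions A" "f \<in> smooth_functions A" "Cinf_tendsto u f F"
    and v: "\<And>i. v i \<in> smooth_functions A" "h \<in> smooth_functions A" "Cinf_tendsto v h F"
  shows Cinf_tendsto_add: "Cinf_tendsto (\<lambda>i x. u i x + v i x) (\<lambda>x. f x + h x) F"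
    and Cinf_tendsto_mult: "Cinf_tendsto (\<lambda>i x. u i x * v i x) (\<lambda>x. f x * h x) F"
  by (rule Cinf_tendstoI,
      rule converges_upto_add[OF chart_props(2) Cinf_tendstoD[OF u(3)] Cinf_tendstoD[OF v(3)]
        smooth_functionsD[OF u(1)] smooth_functionsD[OF v(1)]
        smooth_functionsD[OF u(2)] smooth_functionsD[OF v(2)]]; assumption)
     (rule Cinf_tendstoI,
      rule converges_upto_mult[OF chart_props(2) Cinf_tendstoD[OF u(3)] Cinf_tendstoD[OF v(3)]
        smooth_functionsD[OF u(1)] smooth_functionsD[OF v(1)]
        smooth_functionsD[OF u(2)] smooth_functionsD[OF v(2)]]; assumption)

lemma Cinf_tendsto_inverse:
  assumes "\<And>i. u i \<in> smooth_functions A" "f \<in> smooth_functions A" "Cinf_tendsto u f F"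
    and "\<And>i x. u i x \<noteq> 0" "\<And>x. f x \<noteq> 0"
  shows "Cinf_tendsto (\<lambda>i x. inverse (u i x)) (\<lambda>x. inverse (f x)) F"
  by (rule Cinf_tendstoI,
      rule converges_upto_inverse[OF chart_props(2) Cinf_tendstoD[OF assms(3)]
        smooth_functionsD[OF assms(1)] smooth_functionsD[OF assms(2)]]; (assumption | rule assms))

text \<open>A single point of a chart is compact, so order 0 of the convergence can be evaluated
  there.\<close>

lemma Cinf_tendsto_pointwise:
  assumes "Cinf_tendsto u f F"
  shows "((\<lambda>i. u i x) \<longlongrightarrow> f x) F"
proof -
  obtain c where c: "c \<in> A" "x \<in> fst c" by (rule chart_cover)
  have px: "param c (snd c x) = x"
    using chart_props(3)[OF c(1)] c(2) by (auto simp: homeomorphism_def)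
  have "converges_upto 0 (snd c ` fst c) (\<lambda>i. u i \<circ> param c) (f \<circ> param c) F"
    using assms c unfolding Cinf_tendsto_def by blast
  then have "compact {snd c x} \<and> {snd c x} \<subseteq> snd c ` fst c \<longrightarrow>
      uniform_limit {snd c x} (\<lambda>i. u i \<circ> param c) (f \<circ> param c) F"
    unfolding converges_upto.simps by (rule spec)
  then have "uniform_limit {snd c x} (\<lambda>i. u i \<circ> param c) (f \<circ> param c) F"
    by (rule mp) (use c in simp)
  then have "((\<lambda>i. (u i \<circ> param c) (snd c x)) \<longlongrightarrow> (f \<circ> param c) (snd c x)) F"
    by (rule tendsto_uniform_limitI) simp
  then show ?thesis by (simp add: px)
qed

end

section \<open>Square integrable functions\<close>

lemma square_integrable_measurable: "square_integrable M f \<Longrightarrow> f \<in> borel_measurable M"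
  by (simp add: square_integrable_def)

lemma square_integrable_bound:
  assumes "square_integrable M g" "f \<in> borel_measurable M" "\<And>x. \<bar>f x\<bar> \<le> C * \<bar>g x\<bar>"
  shows "square_integrable M f"
proof -
  have "integrable M (\<lambda>x. C\<^sup>2 * (g x)\<^sup>2)" using assms by (simp add: square_integrable_def)
  moreover have "(f x)\<^sup>2 \<le> C\<^sup>2 * (g x)\<^sup>2" for x
    using power_mono[OF assms(3)[of x], of 2] by (simp add: power_mult_distrib)
  ultimately have "integrable M (\<lambda>x. (f x)\<^sup>2)"
    using assms(2) by (elim Bochner_Integration.integrable_bound) auto
  then show ?thesis using assms by (simp add: square_integrable_def)
qed

lemma integrable_mult_square_integrable:
  assumes "square_integrable M f" "square_integrable M g"
  shows "integrable M (\<lambda>x. f x * g x)"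
proof (rule Bochner_Integration.integrable_bound)
  show "integrable M (\<lambda>x. (f x)\<^sup>2 + (g x)\<^sup>2)" using assms by (simp add: square_integrable_def)
  show "(\<lambda>x. f x * g x) \<in> borel_measurable M"
    using assms by (intro borel_measurable_times square_integrable_measurable)
  have "\<bar>f x * g x\<bar> \<le> (f x)\<^sup>2 + (g x)\<^sup>2" for x
  proof -
    have "2 * (\<bar>f x\<bar> * \<bar>g x\<bar>) \<le> (f x)\<^sup>2 + (g x)\<^sup>2"
      using sum_squares_bound[of "\<bar>f x\<bar>" "\<bar>g x\<bar>"] by (simp add: mult.assoc)
    moreover have "0 \<le> \<bar>f x\<bar> * \<bar>g x\<bar>" by simp
    ultimately show ?thesis unfolding abs_mult by linarith
  qed
  then show "AE x in M. norm (f x * g x) \<le> norm ((f x)\<^sup>2 + (g x)\<^sup>2)" by simp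
qed

lemma square_integrable_add:
  assumes "square_integrable M f" "square_integrable M g"
  shows "square_integrable M (\<lambda>x. f x + g x)"
  using assms integrable_mult_square_integrable[OF assms]
  by (auto simp: square_integrable_def power2_sum mult.assoc intro: borel_measurable_add)

lemma square_integrable_scale:
  "square_integrable M f \<Longrightarrow> square_integrable M (\<lambda>x. a * f x)"
  by (auto simp: square_integrable_def power_mult_distrib intro: borel_measurable_times)

lemma square_integrable_diff:
  assumes "square_integrable M f" "square_integrable M g"
  shows "square_integrable M (\<lambda>x. f x - g x)"
  using square_integrable_add[OF assms(1) square_integrable_scale[OF assms(2), of "-1"]] by simp

text \<open>The integral of (f - a g)^2 is a quadratic polynomial in a that is never
  negative.\<close>

lemma L2_inner_Cauchy_Schwarz:
  assumes f: "square_integrable M f" and g: "square_integrable M g"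
  shows "(L2_inner M f g)\<^sup>2 \<le> (\<integral>x. (f x)\<^sup>2 \<partial>M) * (\<integral>x. (g x)\<^sup>2 \<partial>M)"
proof -
  let ?F = "\<integral>x. (f x)\<^sup>2 \<partial>M" and ?G = "\<integral>x. (g x)\<^sup>2 \<partial>M" and ?I = "L2_inner M f g"
  have i: "integrable M (\<lambda>x. (f x)\<^sup>2)" "integrable M (\<lambda>x. (g x)\<^sup>2)"
    "integrable M (\<lambda>x. f x * g x)"
    using f g integrable_mult_square_integrable[OF f g] by (auto simp: square_integrable_def)
  have q: "0 \<le> ?F - 2 * a * ?I + a\<^sup>2 * ?G" for a
  proof -
    have "0 \<le> (\<integral>x. (f x - a * g x)\<^sup>2 \<partial>M)" by simp
    also have "(\<lambda>x. (f x - a * g x)\<^sup>2) = (\<lambda>x. (f x)\<^sup>2 - (2 * a) * (f x * g x) + a\<^sup>2 * (g x)\<^sup>2)"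
      by (auto simp: power2_eq_square algebra_simps)
    also have "(\<integral>x. (f x)\<^sup>2 - (2 * a) * (f x * g x) + a\<^sup>2 * (g x)\<^sup>2 \<partial>M)
        = ?F - 2 * a * ?I + a\<^sup>2 * ?G"
      using i by (simp add: L2_inner_def)
    finally show ?thesis .
  qed
  show ?thesis
  proof (cases "?G = 0")
    case True
    have "?I = 0"
    proof (rule ccontr)
      assume "?I \<noteq> 0"
      \<comment> \<open>With vanishing leading coefficient the polynomial is affine in a, and this a
        gives it the value -1.\<close>
      then show False using q[of "(?F + 1) / (2 * ?I)"] True by simp
    qed
    then show ?thesis using True by simp
  next
    case False
    then have "?G > 0" by (simp add: less_le)
    \<comment> \<open>This a is the minimizer of the quadratic polynomial.\<close>
    then show ?thesis using q[of "?I / ?G"] by (simp add: field_simps power2_eq_square)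
  qed
qed

text \<open>The difference of the inner products splits into three terms, each with at least one
  factor u - f or v - g; Cauchy-Schwarz sends each of them to 0.\<close>

lemma L2_inner_tendsto:
  assumes u: "\<And>i. square_integrable M (u i)" "square_integrable M f"
      "((\<lambda>i. \<integral>x. (u i x - f x)\<^sup>2 \<partial>M) \<longlongrightarrow> 0) F"
    and v: "\<And>i. square_integrable M (v i)" "square_integrable M g"
      "((\<lambda>i. \<integral>x. (v i x - g x)\<^sup>2 \<partial>M) \<longlongrightarrow> 0) F"
  shows "((\<lambda>i. L2_inner M (u i) (v i)) \<longlongrightarrow> L2_inner M f g) F"
proof -
  have small: "((\<lambda>i. L2_inner M (a i) (b i)) \<longlongrightarrow> 0) F"
    if "\<And>i. square_integrable M (a i)" "\<And>i. square_integrable M (b i)"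
      "((\<lambda>i. (\<integral>x. (a i x)\<^sup>2 \<partial>M) * (\<integral>x. (b i x)\<^sup>2 \<partial>M)) \<longlongrightarrow> 0) F" for a b
  proof -
    have "((\<lambda>i. (L2_inner M (a i) (b i))\<^sup>2) \<longlongrightarrow> 0) F"
      by (rule tendsto_sandwich[OF _ _ tendsto_const that(3)])
        (auto intro!: always_eventually L2_inner_Cauchy_Schwarz that)
    then show ?thesis by simp
  qed
  let ?du = "\<lambda>i x. u i x - f x" and ?dv = "\<lambda>i x. v i x - g x"
  have du: "square_integrable M (?du i)" and dv: "square_integrable M (?dv i)" for i
    using u v by (auto intro: square_integrable_diff)
  have "((\<lambda>i. L2_inner M (?du i) (?dv i) + L2_inner M (?du i) g + L2_inner M f (?dv i)
      + L2_inner M f g) \<longlongrightarrow> 0 + 0 + 0 + L2_inner M f g) F"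
    using du dv u(2) v(2) tendsto_mult[OF u(3) v(3)] tendsto_mult_left[OF v(3)]
      tendsto_mult_right[OF u(3)]
    by (intro tendsto_add tendsto_const small) auto
  moreover have "L2_inner M (?du i) (?dv i) + L2_inner M (?du i) g + L2_inner M f (?dv i)
      + L2_inner M f g = L2_inner M (u i) (v i)" for i
  proof -
    have "L2_inner M (u i) (v i)
        = (\<integral>x. ?du i x * ?dv i x + ?du i x * g x + f x * ?dv i x + f x * g x \<partial>M)"
      unfolding L2_inner_def by (rule Bochner_Integration.integral_cong) (auto simp: algebra_simps)
    also have "\<dots> = L2_inner M (?du i) (?dv i) + L2_inner M (?du i) g + L2_inner M f (?dv i)
      + L2_inner M f g"
      unfolding L2_inner_def
      using integrable_mult_square_integrable[OF du dv, of i i]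
        integrable_mult_square_integrable[OF du v(2), of i]
        integrable_mult_square_integrable[OF u(2) dv, of i]
        integrable_mult_square_integrable[OF u(2) v(2)]
      by (simp del: left_diff_distrib right_diff_distrib)
    finally show ?thesis by simp
  qed
  ultimately show ?thesis by simp
qed

text \<open>Dominated convergence along sequences tending to t: the squared differences are bounded
  by the integrable function (2 C)^2 h^2.\<close>

lemma L2_tendsto_dominated:
  fixes v :: "real \<Rightarrow> 'a \<Rightarrow> real"
  assumes "\<And>s. v s \<in> borel_measurable M" "w \<in> borel_measurable M" "square_integrable M h"
    and v: "\<And>s x. \<bar>v s x\<bar> \<le> C * \<bar>h x\<bar>" and w: "\<And>x. \<bar>w x\<bar> \<le> C * \<bar>h x\<bar>"
    and lim: "\<And>x. ((\<lambda>s. v s x) \<longlongrightarrow> w x) (at t)"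
  shows "((\<lambda>s. \<integral>x. (v s x - w x)\<^sup>2 \<partial>M) \<longlongrightarrow> 0) (at t)"
  unfolding tendsto_at_iff_sequentially
proof (intro allI impI)
  fix S :: "nat \<Rightarrow> real"
  assume S: "\<forall>i. S i \<in> UNIV - {t}" "S \<longlonglongrightarrow> t"
  have "(\<lambda>i. \<integral>x. (v (S i) x - w x)\<^sup>2 \<partial>M) \<longlonglongrightarrow> (\<integral>x. 0 \<partial>M)"
  proof (rule integral_dominated_convergence)
    show "integrable M (\<lambda>x. (2 * C)\<^sup>2 * (h x)\<^sup>2)"
      using assms(3) by (simp add: square_integrable_def)
    show "AE x in M. (\<lambda>i. (v (S i) x - w x)\<^sup>2) \<longlonglongrightarrow> 0"
    proof (rule AE_I2)
      fix x
      have "(\<lambda>i. v (S i) x) \<longlonglongrightarrow> w x"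
        using lim[of x] S unfolding tendsto_at_iff_sequentially comp_def by blast
      from tendsto_power[OF tendsto_diff[OF this tendsto_const[of "w x"]], of 2]
      show "(\<lambda>i. (v (S i) x - w x)\<^sup>2) \<longlonglongrightarrow> 0" by simp
    qed
    show "AE x in M. norm ((v (S i) x - w x)\<^sup>2) \<le> (2 * C)\<^sup>2 * (h x)\<^sup>2" for i
    proof (rule AE_I2)
      fix x
      have "\<bar>v (S i) x - w x\<bar> \<le> 2 * C * \<bar>h x\<bar>" using v[of "S i" x] w[of x] by simp
      from power_mono[OF this, of 2]
      show "norm ((v (S i) x - w x)\<^sup>2) \<le> (2 * C)\<^sup>2 * (h x)\<^sup>2" by (simp add: power_mult_distrib)
    qed
  qed (use assms(1,2) in measurable)
  then show "((\<lambda>s. \<integral>x. (v s x - w x)\<^sup>2 \<partial>M) \<circ> S) \<longlonglongrightarrow> 0" by (simp add: comp_def)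
qed

section \<open>Curves of class \<open>C\<^sup>1\<close>\<close>

context smooth_borel_manifold
begin

section \<open>The vector space \<open>E\<close>, its convergence and its inner product\<close>

abbreviation "E \<equiv> L2_smooth_functions A \<mu>"

lemma E_D:
  assumes "f \<in> E"
  shows "f \<in> smooth_functions A" "square_integrable \<mu> f"
  using assms by (auto simp: L2_smooth_functions_def)

lemma E_I:
  assumes "h \<in> E" "f \<in> smooth_functions A" "\<And>x. \<bar>f x\<bar> \<le> C * \<bar>h x\<bar>"
  shows "f \<in> E"
  unfolding L2_smooth_functions_def
  using assms(2) square_integrable_bound[OF E_D(2)[OF assms(1)]
      smooth_functions_measurable[OF assms(2)] assms(3)] by simp

lemma E_add: "f \<in> E \<Longrightarrow> h \<in> E \<Longrightarrow> (\<lambda>x. f x + h x) \<in> E"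
  by (simp add: L2_smooth_functions_def smooth_functions_add square_integrable_add)

lemma smooth_functions_scale: "f \<in> smooth_functions A \<Longrightarrow> (\<lambda>x. a * f x) \<in> smooth_functions A"
  using smooth_functions_mult[OF smooth_functions_const] .

lemma E_scale: "f \<in> E \<Longrightarrow> (\<lambda>x. a * f x) \<in> E"
  by (simp add: L2_smooth_functions_def smooth_functions_scale square_integrable_scale)

text \<open>At s = 0 division by zero yields the zero function, so the quotient lies in
  \<open>E\<close> for every s. The convergence rules ask for membership of all members of a
  family.\<close>

lemma E_difference_quotient:
  assumes "f \<in> E" "h \<in> E"
  shows "(\<lambda>x. (f x - h x) / s) \<in> E"
proof -
  have "(\<lambda>x. inverse s * (f x + (-1) * h x)) \<in> E"
    by (intro E_scale E_add assms)
  then show ?thesis by (simp add: divide_inverse mult.commute)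
qed

lemma E_tendstoI:
  "Cinf_tendsto u f F \<Longrightarrow> ((\<lambda>i. \<integral>x. (u i x - f x)\<^sup>2 \<partial>\<mu>) \<longlongrightarrow> 0) F \<Longrightarrow>
    E_tendsto A \<mu> u f F"
  by (simp add: E_tendsto_iff)

lemma E_tendstoD:
  assumes "E_tendsto A \<mu> u f F"
  shows "Cinf_tendsto u f F" "((\<lambda>i. \<integral>x. (u i x - f x)\<^sup>2 \<partial>\<mu>) \<longlongrightarrow> 0) F"
  using assms by (simp_all add: E_tendsto_iff)

text \<open>The L2 part follows from (a + b)^2 \<le> 2 a^2 + 2 b^2.\<close>

lemma E_tendsto_add:
  assumes u: "\<And>i. u i \<in> E" "f \<in> E" "E_tendsto A \<mu> u f F"
    and v: "\<And>i. v i \<in> E" "h \<in> E" "E_tendsto A \<mu> v h F"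
  shows "E_tendsto A \<mu> (\<lambda>i x. u i x + v i x) (\<lambda>x. f x + h x) F"
proof (rule E_tendstoI)
  show "Cinf_tendsto (\<lambda>i x. u i x + v i x) (\<lambda>x. f x + h x) F"
    by (intro Cinf_tendsto_add E_D u v E_tendstoD)
  let ?U = "\<lambda>i. \<integral>x. (u i x - f x)\<^sup>2 \<partial>\<mu>" and ?V = "\<lambda>i. \<integral>x. (v i x - h x)\<^sup>2 \<partial>\<mu>"
  have le: "(\<integral>x. (u i x + v i x - (f x + h x))\<^sup>2 \<partial>\<mu>) \<le> 2 * ?U i + 2 * ?V i" for i
  proof -
    have i: "square_integrable \<mu> (\<lambda>x. u i x - f x)" "square_integrable \<mu> (\<lambda>x. v i x - h x)"
      by (intro square_integrable_diff E_D u v)+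
    have "(u i x + v i x - (f x + h x))\<^sup>2 \<le> 2 * (u i x - f x)\<^sup>2 + 2 * (v i x - h x)\<^sup>2" for x
      using sum_squares_bound[of "u i x - f x" "v i x - h x"]
      by (simp add: power2_eq_square algebra_simps)
    then have "(\<integral>x. (u i x + v i x - (f x + h x))\<^sup>2 \<partial>\<mu>)
        \<le> (\<integral>x. 2 * (u i x - f x)\<^sup>2 + 2 * (v i x - h x)\<^sup>2 \<partial>\<mu>)"
      using i by (intro integral_mono') (auto simp: square_integrable_def)
    also have "\<dots> = 2 * ?U i + 2 * ?V i" using i by (simp add: square_integrable_def)
    finally show ?thesis .
  qed
  have lim: "((\<lambda>i. 2 * ?U i + 2 * ?V i) \<longlongrightarrow> 2 * 0 + 2 * 0) F"
    by (intro tendsto_intros E_tendstoD u v)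
  show "((\<lambda>i. \<integral>x. (u i x + v i x - (f x + h x))\<^sup>2 \<partial>\<mu>) \<longlongrightarrow> 0) F"
    by (rule tendsto_sandwich[OF _ _ tendsto_const lim[simplified]])
      (use le in \<open>simp_all add: always_eventually\<close>)
qed

lemma E_tendsto_const: "E_tendsto A \<mu> (\<lambda>i. f) f F"
  by (simp add: E_tendsto_iff Cinf_tendsto_refl)

text \<open>For the L2 part, a u - b f = a (u - f) + (a - b) f, and the square of a sum is at most
  twice the sum of the squares.\<close>

lemma E_tendsto_scale:
  assumes a: "(a \<longlongrightarrow> b) F" and u: "\<And>i. u i \<in> E" "f \<in> E" "E_tendsto A \<mu> u f F"
  shows "E_tendsto A \<mu> (\<lambda>i x. a i * u i x) (\<lambda>x. b * f x) F"
proof (rule E_tendstoI)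
  show "Cinf_tendsto (\<lambda>i x. a i * u i x) (\<lambda>x. b * f x) F"
    by (intro Cinf_tendsto_mult Cinf_tendsto_const smooth_functions_const E_D u E_tendstoD a)
  let ?U = "\<lambda>i. \<integral>x. (u i x - f x)\<^sup>2 \<partial>\<mu>" and ?F = "\<integral>x. (f x)\<^sup>2 \<partial>\<mu>"
  have le: "(\<integral>x. (a i * u i x - b * f x)\<^sup>2 \<partial>\<mu>) \<le> 2 * (a i)\<^sup>2 * ?U i + 2 * (a i - b)\<^sup>2 * ?F" for i
  proof -
    have i: "square_integrable \<mu> (\<lambda>x. u i x - f x)" "square_integrable \<mu> f"
      by (intro square_integrable_diff E_D u)+
    have "(a i * u i x - b * f x)\<^sup>2
        \<le> (2 * (a i)\<^sup>2) * (u i x - f x)\<^sup>2 + (2 * (a i - b)\<^sup>2) * (f x)\<^sup>2" for x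
      using sum_squares_bound[of "a i * (u i x - f x)" "(a i - b) * f x"]
      by (simp add: power2_eq_square algebra_simps)
    then have "(\<integral>x. (a i * u i x - b * f x)\<^sup>2 \<partial>\<mu>)
        \<le> (\<integral>x. (2 * (a i)\<^sup>2) * (u i x - f x)\<^sup>2 + (2 * (a i - b)\<^sup>2) * (f x)\<^sup>2 \<partial>\<mu>)"
      using i by (intro integral_mono') (auto simp: square_integrable_def)
    also have "\<dots> = 2 * (a i)\<^sup>2 * ?U i + 2 * (a i - b)\<^sup>2 * ?F"
      using i by (simp add: square_integrable_def)
    finally show ?thesis .
  qed
  have lim: "((\<lambda>i. 2 * (a i)\<^sup>2 * ?U i + 2 * (a i - b)\<^sup>2 * ?F)
      \<longlongrightarrow> 2 * b\<^sup>2 * 0 + 2 * (b - b)\<^sup>2 * ?F) F"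
    by (intro tendsto_intros E_tendstoD u a)
  show "((\<lambda>i. \<integral>x. (a i * u i x - b * f x)\<^sup>2 \<partial>\<mu>) \<longlongrightarrow> 0) F"
    by (rule tendsto_sandwich[OF _ _ tendsto_const lim[simplified]])
      (use le in \<open>simp_all add: always_eventually\<close>)
qed

lemma E_tendsto_inner:
  assumes "\<And>i. u i \<in> E" "f \<in> E" "E_tendsto A \<mu> u f F"
    and "\<And>i. v i \<in> E" "h \<in> E" "E_tendsto A \<mu> v h F"
  shows "((\<lambda>i. L2_inner \<mu> (u i) (v i)) \<longlongrightarrow> L2_inner \<mu> f h) F"
  by (intro L2_inner_tendsto E_D E_tendstoD assms)

text \<open>Under a common bound by a multiple of |h|, convergence of all derivatives already
  entails L2 convergence, because it contains pointwise convergence.\<close>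

lemma E_tendsto_dominated:
  fixes v :: "real \<Rightarrow> 'm \<Rightarrow> real"
  assumes "\<And>s. v s \<in> smooth_functions A" "w \<in> smooth_functions A" "h \<in> E"
    and "\<And>s x. \<bar>v s x\<bar> \<le> C * \<bar>h x\<bar>" "\<And>x. \<bar>w x\<bar> \<le> C * \<bar>h x\<bar>"
    and "Cinf_tendsto v w (at t)"
  shows "E_tendsto A \<mu> v w (at t)"
  by (intro E_tendstoI L2_tendsto_dominated[where h = h and C = C] smooth_functions_measurable
      Cinf_tendsto_pointwise E_D assms)

lemma E_tendsto_eventually_eq:
  assumes "E_tendsto A \<mu> u f F" "\<forall>\<^sub>F i in F. u i = v i"
  shows "E_tendsto A \<mu> v f F"
proof -
  have ev: "\<forall>\<^sub>F i in F. \<Phi> (u i) = \<Phi> (v i)" for \<Phi> :: "('m \<Rightarrow> real) \<Rightarrow> 'z"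
    using assms(2) by (rule eventually_mono) simp
  show ?thesis
    using assms(1) unfolding E_tendsto_def
    by (auto simp: filterlim_cong[OF refl refl ev[of "\<lambda>w. partials _ (w \<circ> param _)"]]
        filterlim_cong[OF refl refl ev[of "\<lambda>w. L2_norm \<mu> (\<lambda>x. w x - f x)"]])
qed

section \<open>C1 curves in \<open>E\<close>, their scaling and their normalization\<close>

lemma E_tendsto_at_shift:
  "E_tendsto A \<mu> c f (at t) \<longleftrightarrow> E_tendsto A \<mu> (\<lambda>s. c (t + s)) f (at (0::real))"
  unfolding E_tendsto_def by (simp only: filterlim_at_to_0[of _ _ t] add.commute[of t])

definition C1_curve :: "(real \<Rightarrow> 'm \<Rightarrow> real) \<Rightarrow> (real \<Rightarrow> 'm \<Rightarrow> real) \<Rightarrow> bool" where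
  "C1_curve c d \<longleftrightarrow> (\<forall>t. c t \<in> E) \<and> (\<forall>t. d t \<in> E) \<and>
     (\<forall>t. E_tendsto A \<mu> d (d t) (at t)) \<and> (\<forall>t. has_E_derivative A \<mu> c (d t) t)"

text \<open>\<open>C1_curve\<close> names the derivative that \<open>E_curves\<close> only asserts
  to exist; the rules below compute it.\<close>

lemma C1_curve_in_E_curves: "C1_curve c d \<Longrightarrow> c \<in> E_curves A \<mu> 1"
  by (auto simp: C1_curve_def intro!: bexI[of _ d])

lemma C1_curveD:
  assumes "C1_curve c d"
  shows "c t \<in> E" "d t \<in> E" "E_tendsto A \<mu> (\<lambda>s. d (t + s)) (d t) (at 0)"
    "E_tendsto A \<mu> (\<lambda>s x. (c (t + s) x - c t x) / s) (d t) (at 0)"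
  using assms by (auto simp: C1_curve_def has_E_derivative_def simp flip: E_tendsto_at_shift)

text \<open>c (t + s) is c t plus s times the difference quotient, and the quotient converges. The
  identity also holds at s = 0.\<close>

lemma C1_curve_continuous:
  assumes "C1_curve c d"
  shows "E_tendsto A \<mu> (\<lambda>s. c (t + s)) (c t) (at 0)"
proof -
  note c = C1_curveD[OF assms]
  have "E_tendsto A \<mu> (\<lambda>s x. c t x + s * ((c (t + s) x - c t x) / s)) (\<lambda>x. c t x + 0 * d t x) (at 0)"
    by (intro E_tendsto_add E_tendsto_scale E_tendsto_const c E_scale E_difference_quotient
        tendsto_ident_at)
  moreover have "(\<lambda>s x. c t x + s * ((c (t + s) x - c t x) / s)) = (\<lambda>s. c (t + s))"
    by (auto simp: fun_eq_iff)
  ultimately show ?thesis by simp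
qed

text \<open>Product rule: the difference quotient of a c is a (t + s) times that of c, plus that of
  a times c t.\<close>

lemma C1_curve_scale:
  assumes c: "C1_curve c d" and a: "\<And>t. (a has_real_derivative a' t) (at t)"
    and a': "\<And>t. ((\<lambda>s. a' (t + s)) \<longlongrightarrow> a' t) (at 0)"
  shows "C1_curve (\<lambda>t x. a t * c t x) (\<lambda>t x. a t * d t x + a' t * c t x)"
proof -
  note cD = C1_curveD[OF c]
  have a0: "((\<lambda>s. a (t + s)) \<longlongrightarrow> a t) (at 0)" for t
    using DERIV_isCont[OF a[of t]] unfolding isCont_def filterlim_at_to_0[of _ _ t]
    by (simp add: add.commute)
  have "E_tendsto A \<mu> (\<lambda>t x. a t * d t x + a' t * c t x)
      (\<lambda>x. a t * d t x + a' t * c t x) (at t)" for t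
    by (subst E_tendsto_at_shift)
      (intro E_tendsto_add E_tendsto_scale cD C1_curve_continuous[OF c] E_scale a0 a')
  moreover have "has_E_derivative A \<mu> (\<lambda>t x. a t * c t x) (\<lambda>x. a t * d t x + a' t * c t x) t" for t
  proof -
    have "((\<lambda>s. (a (t + s) - a t) / s) \<longlongrightarrow> a' t) (at 0)"
      using a[of t] by (simp add: DERIV_def)
    then have "E_tendsto A \<mu>
        (\<lambda>s x. a (t + s) * ((c (t + s) x - c t x) / s) + ((a (t + s) - a t) / s) * c t x)
        (\<lambda>x. a t * d t x + a' t * c t x) (at 0)"
      by (intro E_tendsto_add E_tendsto_scale cD E_tendsto_const E_scale a0 E_difference_quotient)
    moreover have "(\<lambda>s x. a (t + s) * ((c (t + s) x - c t x) / s) + ((a (t + s) - a t) / s) * c t x)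
        = (\<lambda>s x. (a (t + s) * c (t + s) x - a t * c t x) / s)"
      by (auto simp: fun_eq_iff algebra_simps diff_divide_distrib add_divide_distrib)
    ultimately show ?thesis by (simp add: has_E_derivative_def)
  qed
  ultimately show ?thesis
    unfolding C1_curve_def by (simp add: cD E_add E_scale)
qed

text \<open>Difference of squares: pairing the difference quotient of c with c (t + s) + c t gives
  the difference quotient of the squared norm.\<close>

lemma C1_curve_norm_derivative:
  assumes "C1_curve c d"
  shows "((\<lambda>t. L2_inner \<mu> (c t) (c t)) has_real_derivative 2 * L2_inner \<mu> (d t) (c t)) (at t)"
proof -
  note c = C1_curveD[OF assms]
  let ?q = "\<lambda>s x. (c (t + s) x - c t x) / s"
  have "((\<lambda>s. L2_inner \<mu> (?q s) (\<lambda>x. c (t + s) x + c t x))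
      \<longlongrightarrow> L2_inner \<mu> (d t) (\<lambda>x. c t x + c t x)) (at 0)"
    by (intro E_tendsto_inner E_tendsto_add E_tendsto_const c E_add E_difference_quotient
        C1_curve_continuous[OF assms])
  moreover have "L2_inner \<mu> (?q s) (\<lambda>x. c (t + s) x + c t x)
      = (L2_inner \<mu> (c (t + s)) (c (t + s)) - L2_inner \<mu> (c t) (c t)) / s" for s
  proof -
    have i: "integrable \<mu> (\<lambda>x. c t x * c t x)" for t
      by (intro integrable_mult_square_integrable E_D c)
    have "L2_inner \<mu> (?q s) (\<lambda>x. c (t + s) x + c t x)
        = (\<integral>x. (c (t + s) x * c (t + s) x - c t x * c t x) / s \<partial>\<mu>)"
      unfolding L2_inner_def
      by (rule Bochner_Integration.integral_cong) (auto simp: algebra_simps diff_divide_distrib add_divide_distrib)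
    also have "\<dots> = (L2_inner \<mu> (c (t + s)) (c (t + s)) - L2_inner \<mu> (c t) (c t)) / s"
      using i by (simp add: L2_inner_def)
    finally show ?thesis .
  qed
  moreover have "L2_inner \<mu> (d t) (\<lambda>x. c t x + c t x) = 2 * L2_inner \<mu> (d t) (c t)"
    by (simp add: L2_inner_def mult.left_commute flip: mult_2)
  ultimately show ?thesis by (simp add: DERIV_def)
qed

text \<open>An instance of scaling, with the factor N^(-1/2) for the squared norm N. Its derivative
  is -(1/2) N^(-3/2) N', where the 2 in N' = 2 <d, c> cancels the 1/2.\<close>

lemma C1_curve_normalize:
  assumes c: "C1_curve c d" and pos: "\<And>t. L2_inner \<mu> (c t) (c t) > 0"
  defines "a \<equiv> \<lambda>t. inverse (sqrt (L2_inner \<mu> (c t) (c t)))"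
  shows "C1_curve (\<lambda>t x. a t * c t x)
    (\<lambda>t x. a t * d t x + (- (a t ^ 3) * L2_inner \<mu> (d t) (c t)) * c t x)"
proof (rule C1_curve_scale[OF c])
  show "(a has_real_derivative - (a t ^ 3) * L2_inner \<mu> (d t) (c t)) (at t)" for t
    unfolding a_def using pos[of t]
    by (auto intro!: derivative_eq_intros C1_curve_norm_derivative[OF c]
        simp: power3_eq_cube field_simps)
  have inner: "((\<lambda>s. L2_inner \<mu> (c (t + s)) (c (t + s))) \<longlongrightarrow> L2_inner \<mu> (c t) (c t)) (at 0)"
    "((\<lambda>s. L2_inner \<mu> (d (t + s)) (c (t + s))) \<longlongrightarrow> L2_inner \<mu> (d t) (c t)) (at 0)" for t
    by (intro E_tendsto_inner C1_curveD[OF c] C1_curve_continuous[OF c])+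
  show "((\<lambda>s. - (a (t + s) ^ 3) * L2_inner \<mu> (d (t + s)) (c (t + s)))
      \<longlongrightarrow> - (a t ^ 3) * L2_inner \<mu> (d t) (c t)) (at 0)" for t
    unfolding a_def using pos[of t] by (intro tendsto_intros inner) auto
qed

end

section \<open>Tangent vectors as velocities of curves of positive functions\<close>

context smooth_borel_manifold
begin

section \<open>The damped line through f with initial velocity h\<close>

context
  fixes f h :: "'m \<Rightarrow> real"
  assumes f: "f \<in> E" and f_pos: "\<And>x. f x > 0" and h: "h \<in> E"
begin

definition quot_sq :: "'m \<Rightarrow> real" where
  "quot_sq x = (h x * inverse (f x)) * (h x * inverse (f x))"

text \<open>With r = t h / f, this is the factor 1 / (1 + r^2). It keeps t h \<open>damping\<close>
  at most f / 2 in modulus, however large r becomes.\<close>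

definition damping :: "real \<Rightarrow> 'm \<Rightarrow> real" where
  "damping t x = inverse (1 + t\<^sup>2 * quot_sq x)"

text \<open>
  The difference quotient of \<open>damped_line\<close> between \<open>a\<close> and \<open>b\<close> is \<open>slope a b\<close>, written without
  division by \<open>a - b\<close>; the derivative at \<open>t\<close> is therefore \<open>slope t t\<close>.
\<close>

definition damped_line :: "real \<Rightarrow> 'm \<Rightarrow> real" where
  "damped_line t x = f x + t * (h x * damping t x)"

definition slope :: "real \<Rightarrow> real \<Rightarrow> 'm \<Rightarrow> real" where
  "slope a b x = h x * (damping a x +
     - (b * (a + b)) * (quot_sq x * (damping a x * damping b x)))"

lemma quot_sq_nonneg: "quot_sq x \<ge> 0"
  by (simp add: quot_sq_def)

lemma damping_denominator_pos: "1 + t\<^sup>2 * quot_sq x > 0"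
  using quot_sq_nonneg[of x] by (simp add: add_pos_nonneg)

lemma damping_bounds: "0 < damping t x" "damping t x \<le> 1"
  using damping_denominator_pos[of t x] quot_sq_nonneg[of x]
  by (auto simp: damping_def inverse_le_1_iff)

lemma smooth_quot_sq: "quot_sq \<in> smooth_functions A"
proof -
  have "f x \<noteq> 0" for x using f_pos[of x] by simp
  then have "(\<lambda>x. (h x * inverse (f x)) * (h x * inverse (f x))) \<in> smooth_functions A"
    by (intro smooth_functions_mult smooth_functions_inverse E_D f h)
  then show ?thesis by (simp add: quot_sq_def[abs_def])
qed

lemma smooth_damping: "damping t \<in> smooth_functions A"
proof -
  have "1 + t\<^sup>2 * quot_sq x \<noteq> 0" for x using damping_denominator_pos[of t x] by simp
  then have "(\<lambda>x. inverse (1 + t\<^sup>2 * quot_sq x)) \<in> smooth_functions A"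
    by (intro smooth_functions_inverse smooth_functions_add smooth_functions_const
        smooth_functions_scale smooth_quot_sq)
  then show ?thesis by (simp add: damping_def[abs_def])
qed

lemma smooth_slope: "slope a b \<in> smooth_functions A"
proof -
  have "(\<lambda>x. h x * (damping a x + - (b * (a + b)) * (quot_sq x * (damping a x * damping b x))))
      \<in> smooth_functions A"
    by (intro smooth_functions_mult smooth_functions_add smooth_functions_const smooth_damping
        smooth_quot_sq E_D h)
  then show ?thesis by (simp add: slope_def[abs_def])
qed

lemma Cinf_tendsto_damping:
  assumes "(a \<longlongrightarrow> t) F"
  shows "Cinf_tendsto (\<lambda>i. damping (a i)) (damping t) F"
proof -
  have nz: "1 + t\<^sup>2 * quot_sq x \<noteq> 0" for t x using damping_denominator_pos[of t x] by simp
  have "Cinf_tendsto (\<lambda>i x. inverse (1 + (a i)\<^sup>2 * quot_sq x)) (\<lambda>x. inverse (1 + t\<^sup>2 * quot_sq x)) F"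
    by (intro Cinf_tendsto_inverse Cinf_tendsto_add Cinf_tendsto_mult Cinf_tendsto_const
        Cinf_tendsto_refl smooth_functions_add smooth_functions_mult smooth_functions_const
        smooth_quot_sq tendsto_intros assms nz)
  then show ?thesis by (simp add: damping_def[abs_def])
qed

lemma Cinf_tendsto_slope:
  assumes "(a \<longlongrightarrow> a0) F" "(b \<longlongrightarrow> b0) F"
  shows "Cinf_tendsto (\<lambda>i. slope (a i) (b i)) (slope a0 b0) F"
proof -
  have "Cinf_tendsto
      (\<lambda>i x. h x * (damping (a i) x +
        - (b i * (a i + b i)) * (quot_sq x * (damping (a i) x * damping (b i) x))))
      (\<lambda>x. h x * (damping a0 x + - (b0 * (a0 + b0)) * (quot_sq x * (damping a0 x * damping b0 x)))) F"
    by (intro Cinf_tendsto_add Cinf_tendsto_mult Cinf_tendsto_const Cinf_tendsto_refl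
        Cinf_tendsto_damping smooth_functions_add smooth_functions_mult smooth_functions_const
        smooth_quot_sq smooth_damping tendsto_intros assms E_D h)
  then show ?thesis by (simp add: slope_def[abs_def])
qed

lemma damping_sq_le: "t\<^sup>2 * quot_sq x * damping t x \<le> 1"
  using damping_denominator_pos[of t x] by (simp add: damping_def divide_simps flip: divide_inverse)

text \<open>The factor multiplying h splits into three terms of modulus at most 1, uniformly in a
  and b although \<open>quot_sq\<close> may be unbounded: each square a^2 or b^2 is absorbed by the
  damping with the same parameter.\<close>

lemma slope_bound: "\<bar>slope a b x\<bar> \<le> 3 * \<bar>h x\<bar>"
proof -
  let ?q = "quot_sq x" and ?a = "damping a x" and ?b = "damping b x"
  note bounds = damping_bounds[of a x] damping_bounds[of b x] quot_sq_nonneg[of x]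
  have A: "0 \<le> a\<^sup>2 * ?q * ?a" "a\<^sup>2 * ?q * ?a \<le> 1" and B: "0 \<le> b\<^sup>2 * ?q * ?b" "b\<^sup>2 * ?q * ?b \<le> 1"
    using bounds damping_sq_le by auto
  have "(a\<^sup>2 * ?q * ?a) * ?b \<le> 1" "(b\<^sup>2 * ?q * ?b) * ?a \<le> 1"
    using mult_mono[OF A(2) bounds(4)] mult_mono[OF B(2) bounds(2)] bounds by auto
  moreover have "0 \<le> (a\<^sup>2 * ?q * ?a) * ?b" "0 \<le> (b\<^sup>2 * ?q * ?b) * ?a"
    using A B bounds by simp_all
  \<comment> \<open>The mixed term b a is reduced to the two squares by 2 |a b| \<le> a^2 +
    b^2.\<close>
  moreover have "2 * (\<bar>b * a\<bar> * (?q * (?a * ?b)))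
      \<le> (a\<^sup>2 * ?q * ?a) * ?b + (b\<^sup>2 * ?q * ?b) * ?a"
  proof -
    have "2 * \<bar>b * a\<bar> \<le> a\<^sup>2 + b\<^sup>2"
      using sum_squares_bound[of "\<bar>a\<bar>" "\<bar>b\<bar>"] by (simp add: abs_mult mult_ac)
    then have "2 * \<bar>b * a\<bar> * (?q * (?a * ?b)) \<le> (a\<^sup>2 + b\<^sup>2) * (?q * (?a * ?b))"
      by (rule mult_right_mono) (use bounds in simp)
    then show ?thesis by (simp add: algebra_simps)
  qed
  moreover have "\<bar>b * a * (?q * (?a * ?b))\<bar> = \<bar>b * a\<bar> * (?q * (?a * ?b))"
    using bounds by (simp add: abs_mult)
  moreover have "?a + - (b * (a + b)) * (?q * (?a * ?b))
      = ?a - b * a * (?q * (?a * ?b)) - (b\<^sup>2 * ?q * ?b) * ?a"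
    by (simp add: algebra_simps power2_eq_square)
  ultimately have "\<bar>?a + - (b * (a + b)) * (?q * (?a * ?b))\<bar> \<le> 3"
    using bounds by linarith
  from mult_right_mono[OF this, of "\<bar>h x\<bar>"] show ?thesis
    unfolding slope_def abs_mult[of "h x"] by (simp add: mult.commute)
qed

lemma slope_in_E: "slope a b \<in> E"
  by (rule E_I[OF h smooth_slope slope_bound])

lemma E_tendsto_slope:
  fixes a b :: "real \<Rightarrow> real"
  assumes "(a \<longlongrightarrow> a0) (at t)" "(b \<longlongrightarrow> b0) (at t)"
  shows "E_tendsto A \<mu> (\<lambda>s. slope (a s) (b s)) (slope a0 b0) (at t)"
  by (rule E_tendsto_dominated[OF smooth_slope smooth_slope h slope_bound slope_bound
        Cinf_tendsto_slope[OF assms]])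

lemma damped_line_difference_quotient:
  assumes "s \<noteq> 0"
  shows "(damped_line (t + s) x - damped_line t x) / s = slope (t + s) t x"
proof -
  let ?q = "quot_sq x" and ?a = "damping (t + s) x" and ?b = "damping t x"
  have "?a * (1 + (t + s)\<^sup>2 * ?q) = 1" "?b * (1 + t\<^sup>2 * ?q) = 1"
    using damping_denominator_pos[of "t + s" x] damping_denominator_pos[of t x]
    by (simp_all add: damping_def)
  \<comment> \<open>Common denominator: each damping is multiplied by the other one times its
    denominator, which is 1.\<close>
  then have "?a - ?b = ?a * (?b * (1 + t\<^sup>2 * ?q)) - (?a * (1 + (t + s)\<^sup>2 * ?q)) * ?b" by simp
  also have "\<dots> = - (s * (2 * t + s)) * (?q * (?a * ?b))"
    by (simp add: algebra_simps power2_eq_square)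
  finally have diff: "?a - ?b = - (s * (2 * t + s)) * (?q * (?a * ?b))" .
  have "damped_line (t + s) x - damped_line t x = h x * (s * ?a + t * (?a - ?b))"
    by (simp add: damped_line_def algebra_simps)
  also have "\<dots> = s * slope (t + s) t x"
    unfolding diff slope_def by (simp add: algebra_simps)
  finally show ?thesis using assms by simp
qed

text \<open>With r = t h / f the claim becomes r / (1 + r^2) \<ge> -1/2, which is (1 + r)^2 \<ge> 0.
  The bound gives positivity for all t and keeps the norm away from 0.\<close>

lemma damped_line_ge: "damped_line t x \<ge> f x / 2"
proof -
  define r where "r = t * (h x * inverse (f x))"
  have D: "1 + t\<^sup>2 * quot_sq x = 1 + r\<^sup>2" by (simp add: r_def quot_sq_def power2_eq_square)
  have "t * h x = f x * r" using f_pos[of x] by (simp add: r_def)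
  then have "t * (h x * damping t x) = f x * (r / (1 + r\<^sup>2))"
    unfolding damping_def D by (simp add: divide_inverse flip: mult.assoc)
  moreover have "0 \<le> (1 + r)\<^sup>2" by simp
  then have "r / (1 + r\<^sup>2) \<ge> - (1/2)"
    by (simp add: field_simps add_pos_nonneg power2_sum)
  then have "f x * (r / (1 + r\<^sup>2)) \<ge> f x * - (1/2)"
    using f_pos[of x] by (intro mult_left_mono) auto
  ultimately show ?thesis unfolding damped_line_def by linarith
qed

lemma damped_line_in_E: "damped_line t \<in> E"
proof -
  have "(\<lambda>x. h x * damping t x) \<in> E"
  proof (rule E_I[OF h])
    show "(\<lambda>x. h x * damping t x) \<in> smooth_functions A"
      by (intro smooth_functions_mult smooth_damping E_D h)
    show "\<bar>h x * damping t x\<bar> \<le> 1 * \<bar>h x\<bar>" for x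
      using damping_bounds[of t x] by (simp add: abs_mult mult_left_le)
  qed
  then show ?thesis
    unfolding damped_line_def[abs_def] by (intro E_add E_scale f)
qed

lemma C1_curve_damped_line: "C1_curve damped_line (\<lambda>t. slope t t)"
  unfolding C1_curve_def
proof (intro conjI allI)
  show "has_E_derivative A \<mu> damped_line (slope t t) t" for t
    unfolding has_E_derivative_def
  \<comment> \<open>At s = 0 the quotient is 0 by convention while the slope is the derivative, so
    the two families are compared only for s different from 0.\<close>
  proof (rule E_tendsto_eventually_eq)
    have "((\<lambda>s. t + s) \<longlongrightarrow> t + 0) (at 0)" by (intro tendsto_intros)
    then show "E_tendsto A \<mu> (\<lambda>s. slope (t + s) t) (slope t t) (at 0)"
      by (intro E_tendsto_slope) simp_all
    show "\<forall>\<^sub>F s in at 0. slope (t + s) t = (\<lambda>x. (damped_line (t + s) x - damped_line t x) / s)"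
      by (auto simp: eventually_at_filter damped_line_difference_quotient)
  qed
qed (auto intro: damped_line_in_E slope_in_E E_tendsto_slope tendsto_ident_at)

lemma damped_line_0: "damped_line 0 = f" "slope 0 0 = h"
  by (auto simp: damped_line_def slope_def damping_def)

end

section \<open>Tangent vectors of the positive sphere\<close>

lemma PosSphere_D:
  assumes "f \<in> PosSphere A \<mu>"
  shows "f \<in> E" "f x > 0" "f \<in> smooth_functions A" "L2_inner \<mu> f f = 1"
proof -
  show sm: "f \<in> smooth_functions A" and "f x > 0" and inner: "L2_inner \<mu> f f = 1"
    using assms by (auto simp: PosSphere_def Sphere_def L2_norm_def)
  \<comment> \<open>A non-integrable function would have integral 0 instead of 1.\<close>
  have "integrable \<mu> (\<lambda>x. (f x)\<^sup>2)"
    using inner not_integrable_integral_eq[of \<mu> "\<lambda>x. (f x)\<^sup>2"]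
    by (auto simp: L2_inner_def power2_eq_square)
  then show "f \<in> E"
    using sm smooth_functions_measurable[OF sm]
    by (simp add: L2_smooth_functions_def square_integrable_def)
qed

lemma velocity_eq:
  assumes "C1_curve c d"
  shows "velocity c = d 0"
proof -
  have "((\<lambda>t. c t x) has_real_derivative d 0 x) (at 0)" for x
    using assms by (intro has_E_derivative_pointwise[OF atlas, where \<mu> = \<mu>]) (simp add: C1_curve_def)
  then show ?thesis by (auto simp: velocity_def DERIV_imp_deriv)
qed

text \<open>Supplies the curve that \<open>has_differential\<close> demands. The straight line f + t
  h may leave the positive functions for every t other than 0, which is why the damped line is
  normalized instead.\<close>

theorem tangent_vector_is_velocity:
  assumes f: "f \<in> PosSphere A \<mu>" and h: "h \<in> Sphere_tangent A \<mu> f"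
  shows "\<exists>c\<in>PosSphere_curves A \<mu> 1. c 0 = f \<and> velocity c = h"
proof -
  have hE: "h \<in> E" and orth: "L2_inner \<mu> f h = 0"
    using h by (auto simp: Sphere_tangent_def L2_smooth_functions_def)
  note fD = PosSphere_D[OF f]
  note facts = fD(1) fD(2) hE
  let ?u = "damped_line f h" and ?d = "\<lambda>t. slope f h t t"
  let ?N = "\<lambda>t. L2_inner \<mu> (?u t) (?u t)"
  have C1: "C1_curve ?u ?d" by (rule C1_curve_damped_line[OF facts])
  have u_pos: "?u t x > 0" for t x
    using damped_line_ge[OF facts, of x t] fD(2)[of x] by linarith
  \<comment> \<open>Squaring the bound \<open>damped_line\<close> \<ge> f / 2 and integrating gives
    a squared norm of at least 1/4.\<close>
  have N_pos: "?N t > 0" for t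
  proof -
    have "(1/4) * L2_inner \<mu> f f = (\<integral>x. (1/4) * (f x * f x) \<partial>\<mu>)" by (simp add: L2_inner_def)
    also have "\<dots> \<le> ?N t"
      unfolding L2_inner_def
    proof (rule integral_mono)
      show "integrable \<mu> (\<lambda>x. (1/4) * (f x * f x))" "integrable \<mu> (\<lambda>x. ?u t x * ?u t x)"
        by (intro integrable_mult_right integrable_mult_square_integrable E_D(2) fD(1)
            C1_curveD(1)[OF C1])+
      show "(1/4) * (f x * f x) \<le> ?u t x * ?u t x" for x
        using mult_mono[OF damped_line_ge[OF facts, of x t] damped_line_ge[OF facts, of x t]]
          u_pos[of t x] fD(2)[of x] by simp
    qed
    finally show ?thesis using fD(4) by simp
  qed
  define a where "a t = inverse (sqrt (?N t))" for t
  define c where "c t x = a t * ?u t x" for t x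
  have c: "C1_curve c (\<lambda>t x. a t * ?d t x + (- (a t ^ 3) * L2_inner \<mu> (?d t) (?u t)) * ?u t x)"
    unfolding c_def[abs_def] a_def by (rule C1_curve_normalize[OF C1 N_pos])
  have a0: "a 0 = 1" by (simp add: a_def damped_line_0[OF facts] fD(4))
  have a_pos: "a t > 0" for t using N_pos[of t] by (simp add: a_def)
  have "L2_inner \<mu> (c t) (c t) = 1" for t
  proof -
    have "L2_inner \<mu> (c t) (c t) = (a t)\<^sup>2 * ?N t"
      by (simp add: L2_inner_def c_def power2_eq_square mult_ac flip: integral_mult_right_zero)
    then show ?thesis using N_pos[of t] by (simp add: a_def power_inverse)
  qed
  then have "c t \<in> PosSphere A \<mu>" for t
    using E_D(1)[OF C1_curveD(1)[OF c]] a_pos u_pos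
    by (auto simp: PosSphere_def Sphere_def L2_norm_def c_def)
  moreover have "c t \<in> Sphere A \<mu>" if "c t \<in> PosSphere A \<mu>" for t
    using that by (simp add: PosSphere_def)
  ultimately have "c \<in> PosSphere_curves A \<mu> 1"
    using C1_curve_in_E_curves[OF c]
    unfolding PosSphere_curves_def Sphere_curves_def substructure_def by blast
  moreover have "c 0 = f" by (auto simp: c_def a0 damped_line_0[OF facts])
  \<comment> \<open>At t = 0 the derivative is h - <h, f> f, and the second term vanishes by
    orthogonality.\<close>
  moreover have "velocity c = h"
    using orth by (simp add: velocity_eq[OF c] a0 damped_line_0[OF facts] L2_inner_def mult.commute)
  ultimately show ?thesis by blast
qed

end
section \<open>The square root map\<close>

context smooth_borel_manifold
begin

lemma sqrt_map_in_PosSphere: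
  assumes "\<rho> \<in> Dens A \<mu>"
  shows "sqrt_map \<rho> \<in> PosSphere A \<mu>"
proof -
  have \<rho>: "\<rho> \<in> smooth_functions A" "(\<integral>x. \<rho> x \<partial>\<mu>) = 1" "\<rho> x > 0" for x
    using assms by (auto simp: Dens_def)
  have "sqrt (\<rho> x) * sqrt (\<rho> x) = \<rho> x" for x using \<rho>(3)[of x] by simp
  then show ?thesis
    using \<rho> smooth_functions_sqrt[OF \<rho>(1,3)]
    by (simp add: PosSphere_def Sphere_def sqrt_map_def[abs_def] L2_norm_def L2_inner_def)
qed

lemma square_in_Dens:
  assumes "f \<in> PosSphere A \<mu>"
  shows "(\<lambda>x. (f x)\<^sup>2) \<in> Dens A \<mu>" "sqrt_map (\<lambda>x. (f x)\<^sup>2) = f"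
  using PosSphere_D[OF assms] smooth_functions_mult[of f f]
  by (auto simp: Dens_def L2_inner_def sqrt_map_def fun_eq_iff power2_eq_square less_imp_le
      dest: less_imp_neq)

lemma bij_betw_sqrt_map: "bij_betw sqrt_map (Dens A \<mu>) (PosSphere A \<mu>)"
proof (rule bij_betw_byWitness[where f' = "\<lambda>f x. (f x)\<^sup>2"])
  show "\<forall>\<rho>\<in>Dens A \<mu>. (\<lambda>x. (sqrt_map \<rho> x)\<^sup>2) = \<rho>"
    by (auto simp: Dens_def sqrt_map_def fun_eq_iff less_imp_le)
qed (use sqrt_map_in_PosSphere square_in_Dens in auto)

text \<open>Forward smoothness is the definition of the transported structure. Backward, composing a
  curve with the inverse and then with the square root returns the curve.\<close>

lemma diffeomorphism_sqrt_map:
  "diffeomorphism (Dens A \<mu>) (Dens_curves A \<mu>) (PosSphere A \<mu>) (PosSphere_curves A \<mu>) sqrt_map"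
  unfolding diffeomorphism_def
proof (intro conjI bij_betw_sqrt_map)
  show "smooth_map (Dens_curves A \<mu>) (PosSphere_curves A \<mu>) sqrt_map"
    by (simp add: smooth_map_def Dens_curves_def transported_def)
  let ?inv = "inv_into (Dens A \<mu>) sqrt_map"
  show "smooth_map (PosSphere_curves A \<mu>) (Dens_curves A \<mu>) ?inv"
    unfolding smooth_map_def
  proof (intro allI ballI)
    fix k c assume c: "c \<in> PosSphere_curves A \<mu> k"
    then have "c t \<in> PosSphere A \<mu>" for t
      by (auto simp: PosSphere_curves_def substructure_def)
    then have "?inv (c t) \<in> Dens A \<mu>" "sqrt_map (?inv (c t)) = c t" for t
      using bij_betw_sqrt_map inv_into_into[of "c t" sqrt_map "Dens A \<mu>"]
        f_inv_into_f[of "c t" sqrt_map "Dens A \<mu>"] by (simp_all add: bij_betw_def)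
    then show "?inv \<circ> c \<in> Dens_curves A \<mu> k"
      using c by (auto simp: Dens_curves_def transported_def o_def)
  qed
qed

section \<open>The differential of the square root\<close>

lemma PosSphere_curve_differentiable:
  assumes "c \<in> PosSphere_curves A \<mu> 1"
  shows "((\<lambda>t. c t x) has_real_derivative velocity c x) (at 0)"
proof -
  have "c \<in> E_curves A \<mu> (Suc 0)"
    using assms by (simp add: PosSphere_curves_def Sphere_curves_def substructure_def)
  then obtain d where "\<forall>t. has_E_derivative A \<mu> c (d t) t" by auto
  then have "has_E_derivative A \<mu> c (d 0) 0" by blast
  from has_E_derivative_pointwise[OF atlas this]
  have der: "((\<lambda>t. c t x) has_real_derivative d 0 x) (at 0)" .
  then show ?thesis unfolding velocity_def DERIV_imp_deriv[OF der] .
qed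

text \<open>The chain rule is applied to squaring: the structure grants differentiability of the
  root of the curve, and that of the curve itself follows.\<close>

lemma Dens_velocity:
  assumes "c \<in> Dens_curves A \<mu> 1"
  shows "velocity c x = 2 * sqrt (c 0 x) * velocity (sqrt_map \<circ> c) x"
proof -
  have c: "sqrt_map \<circ> c \<in> PosSphere_curves A \<mu> 1" "c t x > 0" for t x
    using assms by (auto simp: Dens_curves_def transported_def Dens_def)
  have "((\<lambda>t. (sqrt_map (c t) x)\<^sup>2) has_real_derivative
      2 * sqrt (c 0 x) * velocity (sqrt_map \<circ> c) x) (at 0)"
    using DERIV_power[OF PosSphere_curve_differentiable[OF c(1), of x], of 2]
    by (simp add: sqrt_map_def mult_ac)
  moreover have "(\<lambda>t. (sqrt_map (c t) x)\<^sup>2) = (\<lambda>t. c t x)"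
    using c(2) by (auto simp: sqrt_map_def fun_eq_iff less_imp_le)
  ultimately show ?thesis by (simp add: velocity_def DERIV_imp_deriv)
qed

text \<open>The product of sqrt \<rho> and \<theta> / (2 sqrt \<rho>) is \<theta> / 2, so
  orthogonality to sqrt \<rho> is the condition that \<theta> has integral 0.\<close>

lemma sqrt_differential_tangent:
  assumes \<rho>: "\<rho> \<in> Dens A \<mu>" and \<theta>: "\<theta> \<in> Dens_tangent A \<mu> \<rho>"
  shows "(\<lambda>x. \<theta> x / (2 * sqrt (\<rho> x))) \<in> Sphere_tangent A \<mu> (sqrt_map \<rho>)"
proof -
  have pos: "\<rho> x > 0" for x using \<rho> by (simp add: Dens_def)
  note f = PosSphere_D[OF sqrt_map_in_PosSphere[OF \<rho>]]
  have "sqrt_map \<rho> x \<noteq> 0" for x using f(2)[of x] by simp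
  then have "(\<lambda>x. (1/2) * (\<theta> x * inverse (sqrt_map \<rho> x))) \<in> smooth_functions A"
    using \<theta> by (intro smooth_functions_scale smooth_functions_mult smooth_functions_inverse f(3))
      (auto simp: Dens_tangent_def)
  then have "(\<lambda>x. \<theta> x / (2 * sqrt (\<rho> x))) \<in> smooth_functions A"
    by (simp add: sqrt_map_def field_simps)
  moreover have "square_integrable \<mu> (\<lambda>x. (1/2) * (\<theta> x / sqrt (\<rho> x)))"
    using \<theta> by (intro square_integrable_scale) (simp add: Dens_tangent_def)
  then have "square_integrable \<mu> (\<lambda>x. \<theta> x / (2 * sqrt (\<rho> x)))" by simp
  moreover have "sqrt (\<rho> x) * (\<theta> x / (2 * sqrt (\<rho> x))) = \<theta> x / 2" for x
    using pos[of x] by simp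
  then have "L2_inner \<mu> (sqrt_map \<rho>) (\<lambda>x. \<theta> x / (2 * sqrt (\<rho> x))) = (\<integral>x. \<theta> x / 2 \<partial>\<mu>)"
    unfolding L2_inner_def sqrt_map_def by (rule Bochner_Integration.integral_cong[OF refl])
  then have "L2_inner \<mu> (sqrt_map \<rho>) (\<lambda>x. \<theta> x / (2 * sqrt (\<rho> x))) = 0"
    using \<theta> by (simp add: Dens_tangent_def)
  ultimately show ?thesis by (simp add: Sphere_tangent_def)
qed

text \<open>The required curve through \<rho> is the pointwise square of a curve on the sphere. For
  any other curve with velocity \<theta>, \<open>Dens_velocity\<close> is solved for the velocity of
  its root.\<close>

lemma has_differential_sqrt_map:
  assumes \<rho>: "\<rho> \<in> Dens A \<mu>" and \<theta>: "\<theta> \<in> Dens_tangent A \<mu> \<rho>"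
  shows "has_differential (Dens_curves A \<mu>) (PosSphere_curves A \<mu>) sqrt_map \<rho> \<theta>
    (\<lambda>x. \<theta> x / (2 * sqrt (\<rho> x)))"
  unfolding has_differential_def
proof (intro conjI ballI impI)
  have pos: "\<rho> x > 0" for x using \<rho> by (simp add: Dens_def)
  obtain b where b: "b \<in> PosSphere_curves A \<mu> 1" "b 0 = sqrt_map \<rho>"
    "velocity b = (\<lambda>x. \<theta> x / (2 * sqrt (\<rho> x)))"
    using tangent_vector_is_velocity[OF sqrt_map_in_PosSphere[OF \<rho>]
        sqrt_differential_tangent[OF \<rho> \<theta>]] by blast
  have "b t \<in> PosSphere A \<mu>" for t
    using b(1) by (auto simp: PosSphere_curves_def substructure_def)
  note sq = square_in_Dens[OF this]
  have comp: "sqrt_map \<circ> (\<lambda>t x. (b t x)\<^sup>2) = b" using sq(2) by (simp add: fun_eq_iff)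
  have c: "(\<lambda>t x. (b t x)\<^sup>2) \<in> Dens_curves A \<mu> 1"
    using sq(1) comp b(1) by (auto simp: Dens_curves_def transported_def)
  moreover have c0: "(\<lambda>x. (b 0 x)\<^sup>2) = \<rho>"
    using pos by (auto simp: b(2) sqrt_map_def less_imp_le)
  moreover have "velocity (\<lambda>t x. (b t x)\<^sup>2) = \<theta>"
  proof
    fix x
    have "(b 0 x)\<^sup>2 = \<rho> x" using c0 by (rule fun_cong)
    then show "velocity (\<lambda>t x. (b t x)\<^sup>2) x = \<theta> x"
      using Dens_velocity[OF c, of x] pos[of x] by (simp add: comp b(3))
  qed
  ultimately show "\<exists>c\<in>Dens_curves A \<mu> 1. c 0 = \<rho> \<and> velocity c = \<theta>"
    by (intro bexI[of _ "\<lambda>t x. (b t x)\<^sup>2"] conjI)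
next
  fix c assume c: "c \<in> Dens_curves A \<mu> 1" "c 0 = \<rho> \<and> velocity c = \<theta>"
  show "sqrt_map \<circ> c \<in> PosSphere_curves A \<mu> 1"
    using c by (simp add: Dens_curves_def transported_def)
  have "\<rho> x > 0" for x using \<rho> by (simp add: Dens_def)
  then have "2 * sqrt (\<rho> x) \<noteq> 0" for x by (simp add: less_imp_neq[symmetric])
  moreover have "\<theta> x = 2 * sqrt (\<rho> x) * velocity (sqrt_map \<circ> c) x" for x
    using Dens_velocity[OF c(1), of x] c(2) by simp
  ultimately show "velocity (sqrt_map \<circ> c) = (\<lambda>x. \<theta> x / (2 * sqrt (\<rho> x)))"
    by (simp add: fun_eq_iff)
qed

end

text \<open>The existence clause of \<open>has_differential\<close> provides one curve, and the
  velocity of its image must equal both values.\<close>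

lemma has_differential_unique:
  assumes "has_differential C D F p v w" "has_differential C D F p v w'"
  shows "w = w'"
  using assms unfolding has_differential_def by blast

lemma differential_eq: "has_differential C D F p v w \<Longrightarrow> differential C D F p v = w"
  unfolding differential_def using has_differential_unique by blast

text \<open>Since \<open>differential\<close> is a definite description, the second conjunct
  certifies that its values are genuine differentials and tangent to the sphere; the metric identity
  in the third then speaks of actual tangent vectors.\<close>

theorem theorem5p3:
  fixes A :: "('m::{t2_space,second_countable_topology}, 'n::finite) chart set"
    and g :: "('m, 'n) metric_tensor"
    and \<mu> :: "'m measure"
  assumes "riemannian_manifold A g"
    and "riemannian_volume A g \<mu>"
  shows "diffeomorphism (Dens A \<mu>) (Dens_curves A \<mu>) (PosSphere A \<mu>) (PosSphere_curves A \<mu>) sqrt_map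
    \<and> (\<forall>\<rho>\<in>Dens A \<mu>. \<forall>\<theta>\<in>Dens_tangent A \<mu> \<rho>.
         has_differential (Dens_curves A \<mu>) (PosSphere_curves A \<mu>) sqrt_map \<rho> \<theta>
           (d_sqrt_map A \<mu> \<rho> \<theta>)
         \<and> d_sqrt_map A \<mu> \<rho> \<theta> \<in> PosSphere_tangent A \<mu> (sqrt_map \<rho>))
    \<and> (\<forall>\<rho>\<in>Dens A \<mu>. \<forall>\<theta>\<in>Dens_tangent A \<mu> \<rho>. \<forall>\<theta>'\<in>Dens_tangent A \<mu> \<rho>.
         PosSphere_metric \<mu> (sqrt_map \<rho>) (d_sqrt_map A \<mu> \<rho> \<theta>) (d_sqrt_map A \<mu> \<rho> \<theta>')
           = FR_metric \<mu> \<rho> \<theta> \<theta>')"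
proof -
  interpret smooth_borel_manifold A \<mu>
    using assms by unfold_locales (auto simp: riemannian_manifold_def riemannian_volume_def)
  have d: "d_sqrt_map A \<mu> \<rho> \<theta> = (\<lambda>x. \<theta> x / (2 * sqrt (\<rho> x)))"
    if "\<rho> \<in> Dens A \<mu>" "\<theta> \<in> Dens_tangent A \<mu> \<rho>" for \<rho> \<theta>
    using that by (intro differential_eq has_differential_sqrt_map)
  have metric: "PosSphere_metric \<mu> (sqrt_map \<rho>)
      (\<lambda>x. \<theta> x / (2 * sqrt (\<rho> x))) (\<lambda>x. \<theta>' x / (2 * sqrt (\<rho> x))) = FR_metric \<mu> \<rho> \<theta> \<theta>'"
    if "\<rho> \<in> Dens A \<mu>" for \<rho> \<theta> \<theta>'
  proof -
    have "\<theta> x / (2 * sqrt (\<rho> x)) * (\<theta>' x / (2 * sqrt (\<rho> x))) = 1/4 * (\<theta> x * \<theta>' x / \<rho> x)" for x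
      using that by (simp add: Dens_def less_imp_le)
    then have "PosSphere_metric \<mu> (sqrt_map \<rho>)
        (\<lambda>x. \<theta> x / (2 * sqrt (\<rho> x))) (\<lambda>x. \<theta>' x / (2 * sqrt (\<rho> x)))
        = (\<integral>x. 1/4 * (\<theta> x * \<theta>' x / \<rho> x) \<partial>\<mu>)"
      unfolding Sphere_metric_def L2_inner_def by (rule Bochner_Integration.integral_cong[OF refl])
    then show ?thesis unfolding FR_metric_def by (simp only: integral_mult_right_zero)
  qed
  show ?thesis
    by (simp add: d metric diffeomorphism_sqrt_map has_differential_sqrt_map
        sqrt_differential_tangent)
qed

end
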